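(* Let $X$ be a complex Banach space with open unit ball $\mathbb{B}$, let $F:\mathbb{B}\to X$ be given by $F(x)=f(x)x$, $x\in\mathbb{B}$, where $f:\mathbb{B}\to\mathbb{C}$ is holomorphic with $f(0)=1$, and let $G(x)=DF(x)x$, $x\in\mathbb{B}$. Then $F$ is quasi-convex of type $B$ on $\mathbb{B}$ if and only if $G$ is starlike on $\mathbb{B}$.
   Context: $DF(x)$ and $D^2F(x)$ denote the first and second Fréchet derivatives, and $D^2F(x)(x^2)=D^2F(x)(x,x)$. For $x\in X\setminus\{0\}$, $T(x)$ is the set of continuous linear functionals $l_x:X\to\mathbb{C}$ with $l_x(x)=\|x\|$ and $\|l_x\|=1$. A holomorphic mapping $F$ on $\mathbb{B}$ is normalized if $F(0)=0$ and $DF(0)=I$ (identity). A normalized holomorphic mapping $F:\mathbb{B}\to X$ is quasi-convex of type $B$ on $\mathbb{B}$ if it is locally biholomorphic on $\mathbb{B}$ (i.e. $DF(x)$ is invertible with bounded inverse for each $x\in\mathbb{B}$) and $$\Re\, l_x\left([DF(x)]^{-1}\left(D^2F(x)(x^2)+DF(x)x\right)\right)>0\quad\text{for all }x\in\mathbb{B}\setminus\{0\},\ l_x\in T(x).$$ A holomorphic mapping $G:\mathbb{B}\to X$ is starlike on $\mathbb{B}$ if it is biholomorphic on $\mathbb{B}$ (injective, with open image and holomorphic inverse) and $G(\mathbb{B})$ is a starlike domain with respect to the origin. *)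

theory Defs
  imports "HOL-Analysis.Analysis"
begin

text \<open>Complex Banach spaces. The real structure of the library classes is required to be the
  restriction of scalars of the complex one.\<close>

class complex_normed_vector = real_normed_vector +
  fixes scaleC :: "complex \<Rightarrow> 'a \<Rightarrow> 'a"  (infixr \<open>*\<^sub>C\<close> 75)
  assumes scaleC_add_right: "c *\<^sub>C (x + y) = c *\<^sub>C x + c *\<^sub>C y"
    and scaleC_add_left: "(c + d) *\<^sub>C x = c *\<^sub>C x + d *\<^sub>C x"
    and scaleC_scaleC: "c *\<^sub>C (d *\<^sub>C x) = (c * d) *\<^sub>C x"
    and scaleC_of_real: "complex_of_real r *\<^sub>C x = r *\<^sub>R x"
    and norm_scaleC: "norm (c *\<^sub>C x) = cmod c * norm x"

class complex_banach = banach + complex_normed_vector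

instantiation complex :: complex_banach
begin

definition scaleC_complex :: "complex \<Rightarrow> complex \<Rightarrow> complex"
  where "scaleC_complex c z = c * z"

instance
  by standard
    (simp_all add: scaleC_complex_def algebra_simps norm_mult scaleR_conv_of_real)

end

definition complex_homogeneous ::
    "('a::complex_normed_vector \<Rightarrow> 'b::complex_normed_vector) \<Rightarrow> bool"
  where "complex_homogeneous L \<longleftrightarrow> (\<forall>c x. L (c *\<^sub>C x) = c *\<^sub>C L x)"

text \<open>Complex Frechet differentiability at every point; meant for open sets. A derivative in the
  sense of \<^const>\<open>has_derivative\<close> is already additive, real-homogeneous and bounded.\<close>

definition holomorphic_map_on ::
    "('a::complex_normed_vector \<Rightarrow> 'b::complex_normed_vector) \<Rightarrow> 'a set \<Rightarrow> bool"
  where "holomorphic_map_on F S \<longleftrightarrow>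
    (\<forall>x\<in>S. \<exists>L. (F has_derivative L) (at x within S) \<and> complex_homogeneous L)"

text \<open>\<open>Fderiv F x\<close> is \<open>DF(x)\<close> as a bounded operator, for \<open>x\<close> in the interior of the domain of
  differentiability. A complex derivative is in particular the (unique) real one. Since the
  bounded operators again form a normed space, \<open>Fderiv (Fderiv F) x\<close> is \<open>D\<^sup>2F(x)\<close>, and
  \<open>Fderiv (Fderiv F) x h k\<close> is \<open>D\<^sup>2F(x)(h, k)\<close>; the complex-linear operators are a closed
  subspace, so it does not matter that the derivative is taken among the real-linear ones.\<close>

definition Fderiv ::
    "('a::real_normed_vector \<Rightarrow> 'b::real_normed_vector) \<Rightarrow> 'a \<Rightarrow> 'a \<Rightarrow>\<^sub>L 'b"
  where "Fderiv F x = Blinfun (frechet_derivative F (at x))"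

definition Fderiv2 ::
    "('a::real_normed_vector \<Rightarrow> 'b::real_normed_vector) \<Rightarrow> 'a \<Rightarrow> 'a \<Rightarrow>\<^sub>L 'a \<Rightarrow>\<^sub>L 'b"
  where "Fderiv2 F x = Fderiv (Fderiv F) x"

text \<open>The set \<open>T(x)\<close>, used for \<open>x \<noteq> 0\<close>. The norm of a functional is its operator norm.\<close>

definition support_functionals :: "'a::complex_normed_vector \<Rightarrow> ('a \<Rightarrow>\<^sub>L complex) set"
  where "support_functionals x =
    {l. complex_homogeneous (blinfun_apply l) \<and>
        blinfun_apply l x = complex_of_real (norm x) \<and> norm l = 1}"

definition normalized_map :: "('a::complex_normed_vector \<Rightarrow> 'a) \<Rightarrow> bool"
  where "normalized_map F \<longleftrightarrow> F 0 = 0 \<and> Fderiv F 0 = id_blinfun"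

definition locally_biholomorphic_on ::
    "('a::complex_normed_vector \<Rightarrow> 'a) \<Rightarrow> 'a set \<Rightarrow> bool"
  where "locally_biholomorphic_on F S \<longleftrightarrow> holomorphic_map_on F S \<and>
    (\<forall>x\<in>S. bij (blinfun_apply (Fderiv F x)) \<and>
            bounded_linear (inv (blinfun_apply (Fderiv F x))))"

definition quasi_convex_type_B :: "('a::complex_banach \<Rightarrow> 'a) \<Rightarrow> bool"
  where "quasi_convex_type_B F \<longleftrightarrow>
    holomorphic_map_on F (ball 0 1) \<and> normalized_map F \<and>
    locally_biholomorphic_on F (ball 0 1) \<and>
    (\<forall>x\<in>ball 0 1 - {0}. \<forall>l\<in>support_functionals x.
      Re (blinfun_apply l (inv (blinfun_apply (Fderiv F x))
        (blinfun_apply (blinfun_apply (Fderiv2 F x) x) x + blinfun_apply (Fderiv F x) x))) > 0)"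

definition biholomorphic_on ::
    "('a::complex_normed_vector \<Rightarrow> 'a) \<Rightarrow> 'a set \<Rightarrow> bool"
  where "biholomorphic_on G S \<longleftrightarrow> holomorphic_map_on G S \<and> inj_on G S \<and>
    open (G ` S) \<and> holomorphic_map_on (inv_into S G) (G ` S)"

definition starlike_domain_origin :: "'a::real_normed_vector set \<Rightarrow> bool"
  where "starlike_domain_origin D \<longleftrightarrow>
    open D \<and> connected D \<and> 0 \<in> D \<and> (\<forall>y\<in>D. closed_segment 0 y \<subseteq> D)"

definition starlike_map :: "('a::complex_banach \<Rightarrow> 'a) \<Rightarrow> bool"
  where "starlike_map G \<longleftrightarrow>
    holomorphic_map_on G (ball 0 1) \<and> biholomorphic_on G (ball 0 1) \<and>
    starlike_domain_origin (G ` ball 0 1)"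

end

theory Submission
  imports Defs "HOL-Complex_Analysis.Complex_Analysis"
begin

text \<open>Write \<open>G(x) = g(x) x\<close> with \<open>g(x) = f(x) + Df(x) x\<close>. Since \<open>D\<^sup>2F(x)(x\<^sup>2)\<close> and \<open>DF(x) x\<close> are multiples of
  \<open>x\<close>, the quasi-convexity condition says that \<open>1 + Dg(x) x / g(x)\<close> has positive real part, which is the
  classical starlikeness condition for the function \<open>z \<mapsto> z g(z u)\<close> of one variable, for every unit vector \<open>u\<close>.
  As \<open>G\<close> preserves complex lines through the origin, injectivity and starlikeness of \<open>G\<close> are decided on
  these slices; the invertibility of \<open>DF(x)\<close> moreover needs \<open>f(x) \<noteq> 0\<close>, which is the fact that a convex function
  of one variable normalized at the origin vanishes only there.\<close>

section \<open>Complex scalar multiplication and derivatives\<close>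

text \<open>On a slice this is Alexander's theorem: with \<open>\<phi>(z) = f(z u)\<close>,
  \<open>F\<close> becomes \<open>z \<phi>(z)\<close> and \<open>G\<close> becomes \<open>z\<close>
  times the derivative of that function. The vector \<open>x\<close> is an eigenvector of
  \<open>DF(x)\<close> with eigenvalue \<open>g(x)\<close>, and \<open>DF(x)\<close> multiplies the
  kernel of \<open>Df(x)\<close> by \<open>f(x)\<close>; hence the two nonvanishing conditions.
  Injectivity of \<open>G\<close> gives the one on \<open>g\<close> directly, while the one on
  \<open>f\<close> needs convexity. Three points do not come from slices alone.
  \<open>Fderiv2 F\<close> is a derivative in operator norm, so \<open>Df\<close> must be
  differentiable in that norm, which takes Cauchy estimates uniform over all directions. The
  condition over \<open>T(x)\<close> carries information only if \<open>T(x)\<close> is nonempty,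
  which takes a Hahn-Banach argument. Openness of the image of \<open>G\<close> and continuity of
  its inverse need control across neighbouring slices; it comes from a scalar equation for the
  factor between \<open>y\<close> and its preimage.\<close>

lemma bounded_bilinear_scaleC:
  "bounded_bilinear ((*\<^sub>C) :: complex \<Rightarrow> 'a::complex_normed_vector \<Rightarrow> 'a)"
proof
  fix c d :: complex and x y :: 'a and r :: real
  show "(c + d) *\<^sub>C x = c *\<^sub>C x + d *\<^sub>C x" by (rule scaleC_add_left)
  show "c *\<^sub>C (x + y) = c *\<^sub>C x + c *\<^sub>C y" by (rule scaleC_add_right)
  show "(r *\<^sub>R c) *\<^sub>C x = r *\<^sub>R (c *\<^sub>C x)"
    by (simp add: scaleR_conv_of_real flip: scaleC_scaleC scaleC_of_real)
  show "c *\<^sub>C (r *\<^sub>R x) = r *\<^sub>R (c *\<^sub>C x)"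
    by (simp add: scaleC_scaleC mult.commute flip: scaleC_of_real)
  show "\<exists>K. \<forall>a b. norm (a *\<^sub>C (b::'a)) \<le> norm a * norm b * K"
    by (rule exI[of _ 1]) (simp add: norm_scaleC)
qed

interpretation scaleC: bounded_bilinear "(*\<^sub>C) :: complex \<Rightarrow> 'a::complex_normed_vector \<Rightarrow> 'a"
  by (rule bounded_bilinear_scaleC)

lemma scaleC_one [simp]: "1 *\<^sub>C x = x"
  using scaleC_of_real[of 1 x] by simp

lemma scaleC_eq_0_iff [simp]: "c *\<^sub>C x = 0 \<longleftrightarrow> c = 0 \<or> x = 0"
  by (metis mult_eq_0_iff norm_eq_zero norm_scaleC)

lemma scaleC_cancel_right: "c *\<^sub>C x = d *\<^sub>C x \<longleftrightarrow> c = d \<or> x = 0"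
  by (metis eq_iff_diff_eq_0 scaleC.diff_left scaleC_eq_0_iff)

lemma Fderiv_eqI: "(F has_derivative blinfun_apply L) (at x) \<Longrightarrow> Fderiv F x = L"
  unfolding Fderiv_def by (metis blinfun_apply_inverse frechet_derivative_at)

lemma Fderiv_apply_eqI: "(F has_derivative L) (at x) \<Longrightarrow> blinfun_apply (Fderiv F x) = L"
  unfolding Fderiv_def
  by (metis bounded_linear_Blinfun_apply frechet_derivative_at has_derivative_bounded_linear)

lemma holomorphic_map_on_Fderiv:
  assumes "holomorphic_map_on F S" "open S" "x \<in> S"
  shows "(F has_derivative blinfun_apply (Fderiv F x)) (at x)"
    and "complex_homogeneous (blinfun_apply (Fderiv F x))"
proof -
  obtain L where "(F has_derivative L) (at x within S)" "complex_homogeneous L"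
    using assms unfolding holomorphic_map_on_def by blast
  moreover then have "(F has_derivative L) (at x)"
    using assms at_within_open by metis
  ultimately show "(F has_derivative blinfun_apply (Fderiv F x)) (at x)"
    "complex_homogeneous (blinfun_apply (Fderiv F x))"
    using Fderiv_apply_eqI by metis+
qed

lemma holomorphic_map_onI:
  assumes "\<And>x. x \<in> S \<Longrightarrow> (F has_derivative L x) (at x)"
    and "\<And>x. x \<in> S \<Longrightarrow> complex_homogeneous (L x)"
  shows "holomorphic_map_on F S"
  unfolding holomorphic_map_on_def using assms has_derivative_at_withinI by blast

lemma holomorphic_map_on_subset:
  "holomorphic_map_on F S \<Longrightarrow> T \<subseteq> S \<Longrightarrow> holomorphic_map_on F T"
  unfolding holomorphic_map_on_def by (meson has_derivative_subset subset_iff)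

lemma holomorphic_map_on_imp_continuous_on:
  "holomorphic_map_on F S \<Longrightarrow> continuous_on S F"
  unfolding holomorphic_map_on_def
  by (meson continuous_on_eq_continuous_within has_derivative_continuous)

lemma complex_homogeneous_complex:
  "complex_homogeneous (L :: 'a::complex_normed_vector \<Rightarrow> complex) \<longleftrightarrow>
    (\<forall>c x. L (c *\<^sub>C x) = c * L x)"
  by (simp add: complex_homogeneous_def scaleC_complex_def)

lemma slice_has_field_derivative:
  fixes f :: "'a::complex_normed_vector \<Rightarrow> complex"
  assumes "(f has_derivative L) (at (x + z *\<^sub>C u))" "complex_homogeneous L"
  shows "((\<lambda>z. f (x + z *\<^sub>C u)) has_field_derivative L u) (at z)"
proof -
  have "((\<lambda>z. x + z *\<^sub>C u) has_derivative (\<lambda>z. z *\<^sub>C u)) (at z)"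
    by (auto intro!: derivative_eq_intros scaleC.bounded_linear_left[THEN bounded_linear.has_derivative])
  from has_derivative_compose[OF this assms(1)] show ?thesis
    using assms(2) by (simp add: has_field_derivative_def complex_homogeneous_complex mult_commute_abs)
qed

lemma scaleC_has_derivative:
  fixes f :: "'a::complex_normed_vector \<Rightarrow> complex"
  assumes "(f has_derivative L) (at x)"
  shows "((\<lambda>x. f x *\<^sub>C x) has_derivative (\<lambda>h. f x *\<^sub>C h + L h *\<^sub>C x)) (at x)"
  using scaleC.FDERIV[OF assms has_derivative_ident] by simp

section \<open>Inverting scalar operators perturbed by rank one\<close>

text \<open>Applying \<open>l\<close> to \<open>w = T h\<close> gives
  \<open>l w = (a + l v) * l h\<close>, which determines \<open>l h\<close> and then
  \<open>h\<close>; \<open>S\<close> is the resulting Sherman-Morrison formula. It serves for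
  \<open>DF(x)\<close> and \<open>DG(x)\<close>, with \<open>v = x\<close>.\<close>

lemma scalar_plus_rank_one_inverse:
  fixes l :: "'a::complex_normed_vector \<Rightarrow> complex"
  assumes "bounded_linear l" "complex_homogeneous l" "a \<noteq> 0" "a + l v \<noteq> 0"
  defines "T \<equiv> \<lambda>h. a *\<^sub>C h + l h *\<^sub>C v"
    and "S \<equiv> \<lambda>w. inverse a *\<^sub>C (w - (l w / (a + l v)) *\<^sub>C v)"
  shows "T (S w) = w" "S (T h) = h" "bounded_linear S" "complex_homogeneous S"
proof -
  interpret l: bounded_linear l by fact
  have hom: "l (c *\<^sub>C x) = c * l x" for c x
    using assms(2) by (simp add: complex_homogeneous_complex)
  have lS: "l (S w) = l w / (a + l v)"
    using assms(3,4) by (simp add: S_def hom l.diff field_simps)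
  show "T (S w) = w"
    unfolding T_def lS using assms(3) by (simp add: S_def scaleC_scaleC)
  have "l (T h) = (a + l v) * l h"
    by (simp add: T_def hom l.add algebra_simps)
  then show "S (T h) = h"
    using assms(3,4) by (simp add: S_def T_def scaleC_scaleC)
  show "bounded_linear S"
    unfolding S_def divide_inverse
    by (intro scaleC.bounded_linear_right[THEN bounded_linear_compose] bounded_linear_sub
        bounded_linear_ident scaleC.bounded_linear_left[THEN bounded_linear_compose]
        bounded_linear_mult_left[THEN bounded_linear_compose] assms(1))
  show "complex_homogeneous S"
    unfolding complex_homogeneous_def S_def
    by (simp add: hom scaleC_scaleC scaleC.diff_right mult.commute mult.left_commute)
qed

section \<open>Cauchy estimates and the second derivative\<close>

lemma slice_holomorphic_on:
  fixes f :: "'a::complex_normed_vector \<Rightarrow> complex"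
  assumes "holomorphic_map_on f (ball x r)" "\<And>z. z \<in> S \<Longrightarrow> norm (z *\<^sub>C h) < r"
  shows "(\<lambda>z. f (x + z *\<^sub>C h)) holomorphic_on S"
    and "z \<in> S \<Longrightarrow>
      ((\<lambda>z. f (x + z *\<^sub>C h)) has_field_derivative blinfun_apply (Fderiv f (x + z *\<^sub>C h)) h) (at z)"
proof -
  have *: "((\<lambda>z. f (x + z *\<^sub>C h)) has_field_derivative blinfun_apply (Fderiv f (x + z *\<^sub>C h)) h) (at z)"
    if "z \<in> S" for z
    using assms(2)[OF that] holomorphic_map_on_Fderiv[OF assms(1) open_ball]
    by (intro slice_has_field_derivative) (auto simp: dist_norm norm_minus_commute)
  then show "z \<in> S \<Longrightarrow>
      ((\<lambda>z. f (x + z *\<^sub>C h)) has_field_derivative blinfun_apply (Fderiv f (x + z *\<^sub>C h)) h) (at z)"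
    by blast
  show "(\<lambda>z. f (x + z *\<^sub>C h)) holomorphic_on S"
    unfolding holomorphic_on_def field_differentiable_def
    using * has_field_derivative_at_within by blast
qed

text \<open>This is the one-variable Cauchy inequality on the slice through \<open>x\<close> in
  direction \<open>h\<close>. The radius \<open>r / (2 * norm h)\<close> makes the closed disc land
  in the open ball, whence the factor 2.\<close>

lemma Fderiv_Cauchy_estimate:
  fixes f :: "'a::complex_normed_vector \<Rightarrow> complex"
  assumes f: "holomorphic_map_on f (ball x r)" and "0 < r"
    and M: "\<And>y. y \<in> ball x r \<Longrightarrow> norm (f y) \<le> M"
  shows "norm (blinfun_apply (Fderiv f x) h) \<le> 2 * M / r * norm h"
proof (cases "h = 0")
  case False
  define s where "s = r / (2 * norm h)"
  have "s > 0" using \<open>0 < r\<close> False by (simp add: s_def)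
  have *: "norm (z *\<^sub>C h) < r" if "z \<in> cball 0 s" for z
  proof -
    have "norm z * norm h \<le> s * norm h"
      using that by (intro mult_right_mono) auto
    then show ?thesis
      using False \<open>0 < r\<close> by (simp add: s_def norm_scaleC)
  qed
  let ?\<phi> = "\<lambda>z. f (x + z *\<^sub>C h)"
  have hol: "?\<phi> holomorphic_on cball 0 s"
    using slice_holomorphic_on(1)[OF f *] by blast
  have "(?\<phi> has_field_derivative blinfun_apply (Fderiv f (x + 0 *\<^sub>C h)) h) (at 0)"
    using slice_holomorphic_on(2)[where S = "cball 0 s" and z = 0, OF f *] \<open>s > 0\<close> by auto
  then have d: "deriv ?\<phi> 0 = blinfun_apply (Fderiv f x) h"
    using DERIV_imp_deriv[of ?\<phi> _ 0] by (simp add: scaleC.zero_left)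
  have "norm ((deriv ^^ 1) ?\<phi> 0) \<le> fact 1 * M / s ^ 1"
  proof (rule Cauchy_inequality)
    show "?\<phi> holomorphic_on ball 0 s" using hol by (rule holomorphic_on_subset) auto
    show "continuous_on (cball 0 s) ?\<phi>" using hol by (rule holomorphic_on_imp_continuous_on)
    show "0 < s" by fact
    fix z :: complex assume "norm (0 - z) = s"
    then show "norm (?\<phi> z) \<le> M"
      using *[of z] by (intro M) (auto simp: dist_norm)
  qed
  then show ?thesis
    using d by (simp add: s_def mult_ac)
qed auto

text \<open>The second derivative of the slice is bounded by Cauchy's inequality on discs about the
  points of the unit disc. The bound depends on \<open>h\<close> only through its norm, hence is
  uniform over directions.\<close>

lemma Fderiv_Taylor_estimate:
  fixes f :: "'a::complex_normed_vector \<Rightarrow> complex"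
  assumes f: "holomorphic_map_on f (ball x r)" and "0 < r"
    and M: "\<And>y. y \<in> ball x r \<Longrightarrow> norm (f y) \<le> M"
    and h: "norm h \<le> r / 4"
  shows "norm (f (x + h) - f x - blinfun_apply (Fderiv f x) h) \<le> 32 * M / r\<^sup>2 * (norm h)\<^sup>2"
proof (cases "h = 0")
  case False
  \<comment> \<open>The slice is defined for \<open>norm z < 4 * s\<close>, and
    \<open>s \<ge> 1\<close> puts every disc of radius \<open>s\<close> about a point of the unit
    disc inside that region. The final constant is \<open>2 * M / s\<^sup>2\<close>.\<close>
  define s where "s = r / (4 * norm h)"
  have "s \<ge> 1" using h False by (simp add: s_def field_simps)
  have *: "norm (z *\<^sub>C h) < r" if "z \<in> ball 0 (4 * s)" for z
  proof -
    have "norm z * norm h < (4 * s) * norm h"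
      using that False by (intro mult_strict_right_mono) auto
    then show ?thesis
      using False \<open>0 < r\<close> by (simp add: s_def norm_scaleC)
  qed
  let ?\<phi> = "\<lambda>z. f (x + z *\<^sub>C h)"
  have hol: "?\<phi> holomorphic_on ball 0 (4 * s)"
    using slice_holomorphic_on(1)[OF f *] by blast
  have "(?\<phi> has_field_derivative blinfun_apply (Fderiv f (x + 0 *\<^sub>C h)) h) (at 0)"
    using slice_holomorphic_on(2)[where S = "ball 0 (4 * s)" and z = 0, OF f *] \<open>s \<ge> 1\<close> by auto
  then have d: "deriv ?\<phi> 0 = blinfun_apply (Fderiv f x) h"
    using DERIV_imp_deriv[of ?\<phi> _ 0] by (simp add: scaleC.zero_left)
  have "cmod ((deriv ^^ 0) ?\<phi> 1 - (\<Sum>i\<le>1. (deriv ^^ i) ?\<phi> 0 * (1 - 0) ^ i / fact i))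
     \<le> (2 * M / s\<^sup>2) * cmod (1 - 0) ^ Suc 1 / fact 1"
  proof (rule complex_Taylor[where S = "cball 0 1"])
    fix i :: nat and z :: complex assume z: "z \<in> cball 0 1"
    have "(deriv ^^ i) ?\<phi> holomorphic_on ball 0 (4 * s)"
      using hol by (rule holomorphic_higher_deriv) simp
    then have "((deriv ^^ i) ?\<phi> has_field_derivative deriv ((deriv ^^ i) ?\<phi>) z) (at z)"
      using z \<open>s \<ge> 1\<close> by (intro holomorphic_derivI) auto
    then show "((deriv ^^ i) ?\<phi> has_field_derivative (deriv ^^ Suc i) ?\<phi> z) (at z within cball 0 1)"
      by (simp add: has_field_derivative_at_within)
  next
    fix z assume z: "z \<in> cball (0::complex) 1"
    have sub: "cball z s \<subseteq> ball 0 (4 * s)"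
      using z \<open>s \<ge> 1\<close> by (simp add: cball_subset_ball_iff)
    have "norm ((deriv ^^ 2) ?\<phi> z) \<le> fact 2 * M / s ^ 2"
    proof (rule Cauchy_inequality)
      show "?\<phi> holomorphic_on ball z s"
        using hol sub by (meson ball_subset_cball holomorphic_on_subset order_trans)
      show "continuous_on (cball z s) ?\<phi>"
        using holomorphic_on_imp_continuous_on[OF hol] sub continuous_on_subset by blast
      show "0 < s" using \<open>s \<ge> 1\<close> by simp
      fix w assume "norm (z - w) = s"
      then have "w \<in> ball 0 (4 * s)" using sub by (auto simp: dist_norm)
      then show "norm (?\<phi> w) \<le> M"
        using *[of w] by (intro M) (auto simp: dist_norm)
    qed
    then show "cmod ((deriv ^^ Suc 1) ?\<phi> z) \<le> 2 * M / s\<^sup>2"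
      by (simp add: numeral_2_eq_2)
  qed auto
  then have "cmod (f (x + h) - (f x + deriv ?\<phi> 0)) \<le> 2 * M / s\<^sup>2"
    by (simp add: scaleC.zero_left)
  also have "2 * M / s\<^sup>2 = 32 * M / r\<^sup>2 * (norm h)\<^sup>2"
    using False \<open>0 < r\<close> by (simp add: s_def power_divide power_mult_distrib)
  finally show ?thesis
    using d by (simp add: diff_diff_eq)
qed auto

lemma has_derivative_quadratic_error:
  assumes L: "bounded_linear L" and "0 < d"
    and K: "\<And>h. norm h < d \<Longrightarrow> norm (F (x + h) - F x - L h) \<le> K * (norm h)\<^sup>2"
  shows "(F has_derivative L) (at x)"
proof (rule has_derivativeI_sandwich[OF \<open>0 < d\<close> L])
  fix y assume "y \<noteq> x" "dist y x < d"
  then show "norm (F y - F x - L (y - x)) / norm (y - x) \<le> K * norm (y - x)"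
    using K[of "y - x"] by (simp add: dist_norm divide_le_eq power2_eq_square mult.assoc)
next
  show "((\<lambda>y. K * norm (y - x)) \<longlongrightarrow> 0) (at x)"
    by (auto intro!: tendsto_eq_intros)
qed

text \<open>Weierstrass's theorem at the centre of a ball. The Cauchy estimate for
  \<open>g m - g n\<close> makes the derivatives Cauchy in operator norm, functionals form a
  complete space because \<open>complex\<close> is complete, and the Taylor bound does not depend on
  \<open>n\<close>, so it survives in the limit.\<close>

lemma uniform_limit_holomorphic_map_has_derivative:
  fixes g :: "nat \<Rightarrow> 'a::complex_normed_vector \<Rightarrow> complex"
  assumes hol: "\<And>n. holomorphic_map_on (g n) (ball x r)" and "0 < r"
    and M: "\<And>n y. y \<in> ball x r \<Longrightarrow> norm (g n y) \<le> M"
    and lim: "uniform_limit (ball x r) g G sequentially"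
  shows "\<exists>L. (G has_derivative blinfun_apply L) (at x) \<and> complex_homogeneous (blinfun_apply L)"
proof -
  have x: "x \<in> ball x r" using \<open>0 < r\<close> by simp
  note D = holomorphic_map_on_Fderiv[OF hol open_ball]
  have "Cauchy (\<lambda>n. Fderiv (g n) x)"
  proof (rule metric_CauchyI)
    fix e :: real assume "e > 0"
    \<comment> \<open>Two errors \<open>e * r / 8\<close> and the Cauchy factor \<open>2 / r\<close>
      combine to \<open>e / 2\<close>.\<close>
    then have "e * r / 8 > 0" using \<open>0 < r\<close> by simp
    then obtain N where N: "\<And>n y. n \<ge> N \<Longrightarrow> y \<in> ball x r \<Longrightarrow> dist (g n y) (G y) < e * r / 8"
      using lim unfolding uniform_limit_sequentially_iff by blast
    show "\<exists>N. \<forall>m\<ge>N. \<forall>n\<ge>N. dist (Fderiv (g m) x) (Fderiv (g n) x) < e"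
    proof (intro exI allI impI)
      fix m n assume mn: "m \<ge> N" "n \<ge> N"
      let ?d = "\<lambda>y. g m y - g n y"
      have d: "(?d has_derivative blinfun_apply (Fderiv (g m) y - Fderiv (g n) y)) (at y)"
        if "y \<in> ball x r" for y
        using has_derivative_diff[OF D(1)[OF that, of m] D(1)[OF that, of n]]
        by (simp add: minus_blinfun.rep_eq)
      have hd: "holomorphic_map_on ?d (ball x r)"
        using d by (rule holomorphic_map_onI)
          (use D(2)[of _ m] D(2)[of _ n] in \<open>auto simp: complex_homogeneous_complex minus_blinfun.rep_eq algebra_simps\<close>)
      have "norm (blinfun_apply (Fderiv (g m) x - Fderiv (g n) x) h) \<le> e / 2 * norm h" for h
      proof -
        have "norm (blinfun_apply (Fderiv ?d x) h) \<le> 2 * (e * r / 4) / r * norm h"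
        proof (rule Fderiv_Cauchy_estimate[OF hd \<open>0 < r\<close>])
          fix y assume y: "y \<in> ball x r"
          show "norm (g m y - g n y) \<le> e * r / 4"
            using N[OF mn(1) y] N[OF mn(2) y] dist_triangle2[of "g m y" "g n y" "G y"]
            by (simp add: dist_norm)
        qed
        then show ?thesis
          using Fderiv_eqI[OF d[OF x]] \<open>0 < r\<close> by simp
      qed
      then have "norm (Fderiv (g m) x - Fderiv (g n) x) \<le> e / 2"
        using \<open>e > 0\<close> by (intro norm_blinfun_bound) auto
      then show "dist (Fderiv (g m) x) (Fderiv (g n) x) < e"
        using \<open>e > 0\<close> by (simp add: dist_norm)
    qed
  qed
  then obtain L where L: "(\<lambda>n. Fderiv (g n) x) \<longlonglongrightarrow> L"
    using convergent_eq_Cauchy by blast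
  have Lh: "(\<lambda>n. blinfun_apply (Fderiv (g n) x) h) \<longlonglongrightarrow> blinfun_apply L h" for h
    by (intro blinfun.tendsto L tendsto_const)
  have G: "(\<lambda>n. g n y) \<longlonglongrightarrow> G y" if "y \<in> ball x r" for y
    using tendsto_uniform_limitI[OF lim that] .
  have "(G has_derivative blinfun_apply L) (at x)"
  proof (rule has_derivative_quadratic_error[OF blinfun.bounded_linear_right])
    show "0 < r / 4" using \<open>0 < r\<close> by simp
    fix h :: 'a assume h: "norm h < r / 4"
    have "(\<lambda>n. norm (g n (x + h) - g n x - blinfun_apply (Fderiv (g n) x) h)) \<longlonglongrightarrow>
        norm (G (x + h) - G x - blinfun_apply L h)"
      using h \<open>0 < r\<close> by (intro tendsto_intros G Lh x) (auto simp: dist_norm)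
    then show "norm (G (x + h) - G x - blinfun_apply L h) \<le> 32 * M / r\<^sup>2 * (norm h)\<^sup>2"
      by (rule LIMSEQ_le_const2) (use Fderiv_Taylor_estimate[OF hol \<open>0 < r\<close> M] h in force)
  qed
  moreover have "complex_homogeneous (blinfun_apply L)"
    unfolding complex_homogeneous_complex
  proof (intro allI)
    fix c h
    have "(\<lambda>n. blinfun_apply (Fderiv (g n) x) (c *\<^sub>C h)) \<longlonglongrightarrow> c * blinfun_apply L h"
      using D(2)[OF x] tendsto_mult_left[OF Lh] by (simp add: complex_homogeneous_complex)
    with Lh[of "c *\<^sub>C h"] show "blinfun_apply L (c *\<^sub>C h) = c * blinfun_apply L h"
      using LIMSEQ_unique by blast
  qed
  ultimately show ?thesis by blast
qed

text \<open>Closed balls are not compact in infinite dimension, so a bound is available only near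
  each point, from continuity. The differentiability claims built on it are local.\<close>

lemma holomorphic_map_on_locally_bounded:
  assumes "holomorphic_map_on f S" "open S" "x \<in> S"
  shows "\<exists>r>0. ball x r \<subseteq> S \<and> (\<forall>y\<in>ball x r. norm (f y) \<le> norm (f x) + 1)"
proof -
  obtain r1 where r1: "r1 > 0" "ball x r1 \<subseteq> S"
    using assms openE by metis
  have "isCont f x"
    using holomorphic_map_on_Fderiv(1)[OF assms] has_derivative_continuous by blast
  then obtain r2 where r2: "r2 > 0" "\<And>y. dist y x < r2 \<Longrightarrow> dist (f y) (f x) < 1"
    unfolding continuous_at_eps_delta by (meson zero_less_one)
  have "norm (f y) \<le> norm (f x) + 1" if "y \<in> ball x (min r1 r2)" for y
  proof -
    have "norm (f y - f x) < 1" using r2(2)[of y] that by (simp add: dist_norm norm_minus_commute)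
    then show ?thesis
      using norm_triangle_sub[of "f y" "f x"] by simp
  qed
  moreover have "ball x (min r1 r2) \<subseteq> S" using r1 by auto
  ultimately show ?thesis
    using r1 r2 by (intro exI[of _ "min r1 r2"]) auto
qed

lemma ball_half_subset:
  fixes x y :: "'a::metric_space"
  assumes "y \<in> ball x (r / 2)"
  shows "ball y (r / 2) \<subseteq> ball x r"
proof
  fix z assume "z \<in> ball y (r / 2)"
  with assms show "z \<in> ball x r" using dist_triangle[of x z y] by simp
qed

lemma Fderiv_norm_bound_on_half_ball:
  fixes f :: "'a::complex_normed_vector \<Rightarrow> complex"
  assumes f: "holomorphic_map_on f (ball x r)" and "0 < r"
    and M: "\<And>y. y \<in> ball x r \<Longrightarrow> norm (f y) \<le> M"
    and y: "y \<in> ball x (r / 2)"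
  shows "norm (blinfun_apply (Fderiv f y) k) \<le> 4 * M / r * norm k"
proof -
  have sub: "ball y (r / 2) \<subseteq> ball x r"
    using y by (rule ball_half_subset)
  have "norm (blinfun_apply (Fderiv f y) k) \<le> 2 * M / (r / 2) * norm k"
    by (rule Fderiv_Cauchy_estimate) (use f M sub \<open>0 < r\<close> holomorphic_map_on_subset in auto)
  then show ?thesis by simp
qed

text \<open>The difference quotients \<open>n (f(x + k/n) - f(x))\<close> converge locally uniformly by Taylor's estimate. The
  estimates for the resulting holomorphic function \<open>Df(x) k\<close> are uniform in \<open>k\<close>, which gives
  differentiability of \<open>Df\<close> in operator norm.\<close>

lemma directional_derivative_holomorphic:
  fixes f :: "'a::complex_normed_vector \<Rightarrow> complex"
  assumes f: "holomorphic_map_on f S" and "open S"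
  shows "holomorphic_map_on (\<lambda>x. blinfun_apply (Fderiv f x) k) S"
proof -
  have "\<exists>L. ((\<lambda>x. blinfun_apply (Fderiv f x) k) has_derivative blinfun_apply L) (at x) \<and>
      complex_homogeneous (blinfun_apply L)" if xS: "x \<in> S" for x
  proof -
    obtain r where r: "0 < r" "ball x r \<subseteq> S" "\<And>y. y \<in> ball x r \<Longrightarrow> norm (f y) \<le> norm (f x) + 1"
      using holomorphic_map_on_locally_bounded[OF assms xS] by blast
    define M where "M = norm (f x) + 1"
    have "M \<ge> 0" by (simp add: M_def)
    note fr = holomorphic_map_on_subset[OF f r(2)]
    note Mr = r(3)[folded M_def]
    \<comment> \<open>The shift by \<open>N\<close> makes \<open>norm k / a n \<le> r / 8\<close>
      for every \<open>n\<close>: this is what the Taylor estimate on a ball of radius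
      \<open>r / 2\<close> requires, and it keeps the translates of the half ball inside
      \<open>ball x r\<close>.\<close>
    obtain N where "8 * norm k / r < real N" using reals_Archimedean2 by blast
    then have N: "norm k \<le> real N * (r / 8)"
      using \<open>0 < r\<close> by (simp add: field_simps)
    define a where "a n = real (Suc n + N)" for n
    have a: "a n > 0" "norm k / a n \<le> r / 8" for n
    proof -
      show "a n > 0" by (simp add: a_def)
      have "norm k \<le> a n * (r / 8)"
        using \<open>0 < r\<close> by (intro order_trans[OF N] mult_right_mono) (auto simp: a_def)
      then show "norm k / a n \<le> r / 8"
        using \<open>a n > 0\<close> by (simp add: pos_divide_le_eq mult.commute)
    qed
    define g where "g n y = of_real (a n) * (f (y + (1 / a n) *\<^sub>R k) - f y)" for n y
    \<comment> \<open>This is \<open>32 * M / (r / 2)\<^sup>2 * (norm k)\<^sup>2\<close>; the factor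
      \<open>a n\<close> in \<open>g n\<close> cancels one of the two factors \<open>1 / a n\<close>
      of the quadratic error.\<close>
    define C where "C = 128 * M / r\<^sup>2 * (norm k)\<^sup>2"
    have "C \<ge> 0" using \<open>M \<ge> 0\<close> by (simp add: C_def)
    have close: "norm (g n y - blinfun_apply (Fderiv f y) k) \<le> C / a n"
      if y: "y \<in> ball x (r / 2)" for n y
    proof -
      have sub: "ball y (r / 2) \<subseteq> ball x r"
        using y by (rule ball_half_subset)
      have "norm (f (y + (1 / a n) *\<^sub>R k) - f y - blinfun_apply (Fderiv f y) ((1 / a n) *\<^sub>R k))
          \<le> 32 * M / (r / 2)\<^sup>2 * (norm ((1 / a n) *\<^sub>R k))\<^sup>2"
        by (rule Fderiv_Taylor_estimate[OF holomorphic_map_on_subset[OF fr sub]])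
          (use \<open>0 < r\<close> Mr sub a[of n] in auto)
      also have "\<dots> = C / (a n)\<^sup>2"
        using a by (simp add: C_def power_divide)
      finally have "a n * norm (f (y + (1 / a n) *\<^sub>R k) - f y - blinfun_apply (Fderiv f y) ((1 / a n) *\<^sub>R k))
          \<le> a n * (C / (a n)\<^sup>2)"
        using a by (intro mult_left_mono) (auto intro: less_imp_le)
      moreover have "g n y - blinfun_apply (Fderiv f y) k = of_real (a n) *
          (f (y + (1 / a n) *\<^sub>R k) - f y - blinfun_apply (Fderiv f y) ((1 / a n) *\<^sub>R k))"
        using a[of n] by (simp add: g_def blinfun.scaleR_right scaleR_conv_of_real algebra_simps)
      ultimately show ?thesis
        using a[of n] by (simp add: norm_mult power2_eq_square)
    qed
    have lim0: "(\<lambda>n. C / a n) \<longlonglongrightarrow> 0"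
      unfolding a_def by real_asymp
    show ?thesis
    proof (rule uniform_limit_holomorphic_map_has_derivative)
      show "0 < r / 2" using \<open>0 < r\<close> by simp
      show "holomorphic_map_on (g n) (ball x (r / 2))" for n
      proof (rule holomorphic_map_onI)
        fix y assume y: "y \<in> ball x (r / 2)"
        have "norm ((1 / a n) *\<^sub>R k) \<le> r / 8" using a[of n] by auto
        then have y1: "y + (1 / a n) *\<^sub>R k \<in> ball x r"
          using y \<open>0 < r\<close> norm_triangle_ineq4[of "x - y" "(1 / a n) *\<^sub>R k"]
          unfolding mem_ball dist_norm diff_diff_eq by linarith
        have y2: "y \<in> ball x r" using y \<open>0 < r\<close> by auto
        note d1 = holomorphic_map_on_Fderiv[OF fr open_ball y1]
        note d2 = holomorphic_map_on_Fderiv[OF fr open_ball y2]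
        have "((\<lambda>y. y + (1 / a n) *\<^sub>R k) has_derivative (\<lambda>h. h)) (at y)"
          by (auto intro!: derivative_eq_intros)
        from has_derivative_compose[OF this d1(1)]
        show "(g n has_derivative (\<lambda>h. of_real (a n) *
            (blinfun_apply (Fderiv f (y + (1 / a n) *\<^sub>R k)) h - blinfun_apply (Fderiv f y) h))) (at y)"
          unfolding g_def by (intro has_derivative_mult_right has_derivative_diff d2(1)) auto
        show "complex_homogeneous (\<lambda>h. of_real (a n) *
            (blinfun_apply (Fderiv f (y + (1 / a n) *\<^sub>R k)) h - blinfun_apply (Fderiv f y) h))"
          using d1(2) d2(2) by (simp add: complex_homogeneous_complex algebra_simps)
      qed
      show "norm (g n y) \<le> C + 4 * M / r * norm k" if y: "y \<in> ball x (r / 2)" for n y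
      proof -
        have "a n \<ge> 1" by (simp add: a_def)
        then have "C / a n \<le> C" using \<open>C \<ge> 0\<close> by (simp add: divide_le_eq mult_left_le mult_le_cancel_left1)
        moreover have "norm (blinfun_apply (Fderiv f y) k) \<le> 4 * M / r * norm k"
          using Fderiv_norm_bound_on_half_ball[OF fr \<open>0 < r\<close> Mr y] by simp
        ultimately show ?thesis
          using close[OF y, of n] norm_triangle_sub[of "g n y" "blinfun_apply (Fderiv f y) k"] by simp
      qed
      show "uniform_limit (ball x (r / 2)) g (\<lambda>y. blinfun_apply (Fderiv f y) k) sequentially"
      proof (rule uniform_limitI)
        fix e :: real assume "e > 0"
        with lim0 have "eventually (\<lambda>n. C / a n < e) sequentially"
          by (rule order_tendstoD)
        then show "\<forall>\<^sub>F n in sequentially. \<forall>y\<in>ball x (r / 2). dist (g n y) (blinfun_apply (Fderiv f y) k) < e"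
          by eventually_elim (auto simp: dist_norm intro: order.strict_trans1[OF close])
      qed
    qed
  qed
  then show ?thesis
    unfolding holomorphic_map_on_def using has_derivative_at_withinI by blast
qed

text \<open>For fixed \<open>k\<close> the map \<open>y \<mapsto> Df(y) k\<close> has a derivative
  \<open>D k\<close>. Uniqueness of derivatives makes \<open>D k\<close> linear in \<open>k\<close>,
  and its Cauchy and Taylor estimates carry a factor \<open>norm k\<close>, so they become estimates
  in operator norm.\<close>

lemma Fderiv_has_derivative:
  fixes f :: "'a::complex_normed_vector \<Rightarrow> complex"
  assumes f: "holomorphic_map_on f S" and "open S" and "x \<in> S"
  obtains B where "(Fderiv f has_derivative B) (at x)"
    and "\<And>k. complex_homogeneous (\<lambda>h. blinfun_apply (B h) k)"
proof -
  obtain r where r: "0 < r" "ball x r \<subseteq> S" "\<And>y. y \<in> ball x r \<Longrightarrow> norm (f y) \<le> norm (f x) + 1"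
    using holomorphic_map_on_locally_bounded[OF assms] by blast
  define M where "M = norm (f x) + 1"
  note fr = holomorphic_map_on_subset[OF f r(2)]
  note Mr = r(3)[folded M_def]
  let ?A = "\<lambda>k y. blinfun_apply (Fderiv f y) k"
  define D where "D k h = blinfun_apply (Fderiv (?A k) x) h" for k h
  have "0 < r / 2" using \<open>0 < r\<close> by simp
  have x: "x \<in> ball x r" using \<open>0 < r\<close> by simp
  have Ahol: "holomorphic_map_on (?A k) (ball x r)" for k
    using directional_derivative_holomorphic[OF fr open_ball] .
  have Ahol2: "holomorphic_map_on (?A k) (ball x (r / 2))" for k
    using \<open>0 < r\<close> by (intro holomorphic_map_on_subset[OF Ahol]) auto
  have Abd: "norm (?A k y) \<le> 4 * M / r * norm k" if "y \<in> ball x (r / 2)" for y k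
    using Fderiv_norm_bound_on_half_ball[OF fr \<open>0 < r\<close> Mr that] .
  have dA: "(?A k has_derivative D k) (at x)" "complex_homogeneous (D k)" for k
    using holomorphic_map_on_Fderiv[OF Ahol open_ball x] unfolding D_def by auto
  have uniq: "D k h = E h" if "(?A k has_derivative E) (at x)" for k h E
    using has_derivative_unique[OF dA(1) that] by simp
  have bil: "bounded_bilinear (\<lambda>h k. D k h)"
  proof
    show "D k (h + h') = D k h + D k h'" for h h' k by (simp add: D_def blinfun.add_right)
    show "D k (c *\<^sub>R h) = c *\<^sub>R D k h" for c h k by (simp add: D_def blinfun.scaleR_right)
    show "D (k + k') h = D k h + D k' h" for h k k'
      using has_derivative_add[OF dA(1)[of k] dA(1)[of k']]
      by (intro uniq) (simp add: blinfun.add_right)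
    show "D (c *\<^sub>R k) h = c *\<^sub>R D k h" for h c k
      using has_derivative_scaleR_right[OF dA(1)[of k]]
      by (intro uniq) (simp add: blinfun.scaleR_right)
    have "norm (D k h) \<le> norm h * norm k * (2 * (4 * M / r) / (r / 2))" for h k
      using Fderiv_Cauchy_estimate[OF Ahol2 \<open>0 < r / 2\<close> Abd, of k h]
      by (simp add: D_def mult_ac)
    then show "\<exists>K. \<forall>h k. norm (D k h) \<le> norm h * norm k * K" by blast
  qed
  define B where "B h = Blinfun (\<lambda>k. D k h)" for h
  have B: "blinfun_apply (B h) k = D k h" for h k
    unfolding B_def using bounded_bilinear.bounded_linear_right[OF bil]
    by (simp add: bounded_linear_Blinfun_apply)
  have "bounded_linear B"
    using bil by (subst transfer_bounded_bilinear_bounded_linearI[symmetric, where g = "\<lambda>h k. D k h"])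
      (auto simp: B fun_eq_iff)
  moreover have "norm (Fderiv f (x + h) - Fderiv f x - B h) \<le>
      32 * (4 * M / r) / (r / 2)\<^sup>2 * (norm h)\<^sup>2" if h: "norm h < r / 8" for h
  proof (rule norm_blinfun_bound)
    have "M \<ge> 0" by (simp add: M_def)
    then show "0 \<le> 32 * (4 * M / r) / (r / 2)\<^sup>2 * (norm h)\<^sup>2"
      using \<open>0 < r\<close> by simp
    fix k
    have "norm (?A k (x + h) - ?A k x - D k h) \<le>
        32 * (4 * M / r * norm k) / (r / 2)\<^sup>2 * (norm h)\<^sup>2"
      unfolding D_def
      using Fderiv_Taylor_estimate[OF Ahol2 \<open>0 < r / 2\<close> Abd, of h k] h by simp
    then show "norm (blinfun_apply (Fderiv f (x + h) - Fderiv f x - B h) k) \<le>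
        32 * (4 * M / r) / (r / 2)\<^sup>2 * (norm h)\<^sup>2 * norm k"
      by (simp add: minus_blinfun.rep_eq B mult_ac)
  qed
  ultimately have "(Fderiv f has_derivative B) (at x)"
    using \<open>0 < r\<close> by (intro has_derivative_quadratic_error[where d = "r / 8"]) (assumption | simp)+
  moreover have "complex_homogeneous (\<lambda>h. blinfun_apply (B h) k)" for k
    using dA(2)[of k] by (simp add: B)
  ultimately show thesis by (rule that)
qed

section \<open>Starlike functions of one variable\<close>

lemma has_real_derivative_Re_of_real:
  assumes "(F has_field_derivative D) (at (complex_of_real a))"
  shows "((\<lambda>t. Re (F (complex_of_real t))) has_real_derivative Re D) (at a)"
  using bounded_linear.has_vector_derivative[OF bounded_linear_Re has_vector_derivative_real_field[OF assms]]
  by (simp add: has_real_derivative_iff_has_vector_derivative)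

text \<open>Let \<open>q\<close> invert \<open>p(z) = z \<gamma>(z)\<close>. Starlikeness makes
  \<open>z \<mapsto> q(t p(z))\<close> a self-map of the disc fixing 0, so Schwarz's lemma gives
  \<open>|q(t p(z))| \<le> |z|\<close>, with equality at \<open>t = 1\<close>. The derivative of
  this modulus at \<open>t = 1\<close> is therefore nonnegative, and it has the sign of
  \<open>Re (1 / Q)\<close> with \<open>Q = z p'(z) / p(z)\<close>.\<close>

lemma starlike_imp_Re_nonneg:
  assumes hol: "\<gamma> holomorphic_on ball 0 1" and nz: "\<gamma> z \<noteq> 0"
    and inj: "inj_on (\<lambda>z. z * \<gamma> z) (ball 0 1)"
    and star: "\<And>z t. z \<in> ball 0 1 \<Longrightarrow> 0 \<le> t \<Longrightarrow> t \<le> 1 \<Longrightarrow>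
      \<exists>w\<in>ball 0 1. w * \<gamma> w = complex_of_real t * (z * \<gamma> z)"
    and z: "z \<in> ball 0 1"
  shows "Re (1 + z * deriv \<gamma> z / \<gamma> z) \<ge> 0"
proof (cases "z = 0")
  case False
  define p where "p z = z * \<gamma> z" for z
  have hp: "p holomorphic_on ball 0 1"
    unfolding p_def by (intro holomorphic_intros hol)
  have injp: "inj_on p (ball 0 1)" using inj by (simp add: p_def[abs_def])
  obtain q where q: "q holomorphic_on p ` ball 0 1"
      "\<And>z. z \<in> ball 0 1 \<Longrightarrow> deriv p z * deriv q (p z) = 1"
      "\<And>z. z \<in> ball 0 1 \<Longrightarrow> q (p z) = z"
    using holomorphic_has_inverse[OF hp open_ball injp] by metis
  have op: "open (p ` ball 0 1)"
    by (rule open_mapping_thm3[OF hp open_ball injp])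
  have tp: "of_real t * p w \<in> p ` ball 0 1" if wt: "w \<in> ball 0 1" "0 \<le> t" "t \<le> 1" for t w
  proof -
    obtain w' where "w' \<in> ball 0 1" "w' * \<gamma> w' = of_real t * (w * \<gamma> w)"
      using star[OF wt] by blast
    then show ?thesis by (intro image_eqI[of _ _ w']) (auto simp: p_def)
  qed
  have le: "norm (q (of_real t * p z)) \<le> norm z" if t: "0 \<le> t" "t \<le> 1" for t
  proof (rule Schwarz_Lemma(1))
    show "(\<lambda>z. q (of_real t * p z)) holomorphic_on ball 0 1"
    proof (rule holomorphic_on_compose_gen[of "\<lambda>z. of_real t * p z" _ q, unfolded o_def])
      show "(\<lambda>z. of_real t * p z) holomorphic_on ball 0 1" by (intro holomorphic_intros hp)
      show "q holomorphic_on p ` ball 0 1" by (rule q)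
      show "(\<lambda>z. of_real t * p z) ` ball 0 1 \<subseteq> p ` ball 0 1" using tp t by auto
    qed
    show "q (of_real t * p 0) = 0" using q(3)[of 0] by (simp add: p_def)
    show "norm z < 1" using z by simp
    fix w :: complex assume "norm w < 1"
    then have "of_real t * p w \<in> p ` ball 0 1" using tp t by simp
    then show "norm (q (of_real t * p w)) < 1" using q(3) by auto
  qed
  \<comment> \<open>\<open>Re (cnj z * w)\<close> replaces the modulus of \<open>w\<close>: it is
    real-linear, at most \<open>norm z * norm w\<close>, and equal to
    \<open>(norm z)\<^sup>2\<close> at \<open>w = z\<close>.\<close>
  define D where "D = cnj z * (deriv q (p z) * p z)"
  have "(q has_field_derivative deriv q (p z)) (at (of_real 1 * p z))"
    using holomorphic_derivI[OF q(1) op] z by auto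
  then have "((\<lambda>s. cnj z * q (s * p z)) has_field_derivative D) (at (of_real 1))"
    unfolding D_def
    by (intro DERIV_cmult DERIV_chain2[where f = q and g = "\<lambda>s. s * p z"])
      (auto intro!: derivative_eq_intros)
  from has_real_derivative_Re_of_real[OF this]
  have dD: "((\<lambda>t. Re (cnj z * q (of_real t * p z))) has_real_derivative Re D) (at 1)" .
  have "Re D \<ge> 0"
  proof (rule ccontr)
    assume "\<not> Re D \<ge> 0"
    then obtain d where d: "d > 0" "\<And>h. h > 0 \<Longrightarrow> h < d \<Longrightarrow>
        Re (cnj z * q (of_real 1 * p z)) < Re (cnj z * q (of_real (1 - h) * p z))"
      using DERIV_neg_dec_left[OF dD] by auto
    define h where "h = min (d / 2) (1 / 2)"
    have h: "h > 0" "h < d" "h \<le> 1" using \<open>d > 0\<close> by (auto simp: h_def)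
    have "Re (cnj z * q (of_real (1 - h) * p z)) \<le> norm (cnj z * q (of_real (1 - h) * p z))"
      by (rule complex_Re_le_cmod)
    also have "\<dots> \<le> norm z * norm z"
      using le[of "1 - h"] h by (simp add: norm_mult mult_left_mono)
    also have "\<dots> = Re (cnj z * q (of_real 1 * p z))"
      using q(3)[OF z] by (simp add: cmod_def power2_eq_square flip: power2_eq_square)
    finally show False using d(2)[OF h(1,2)] by simp
  qed
  have "(\<gamma> has_field_derivative deriv \<gamma> z) (at z)"
    by (rule holomorphic_derivI[OF hol open_ball z])
  then have "(p has_field_derivative \<gamma> z + z * deriv \<gamma> z) (at z)"
    unfolding p_def by (auto intro!: derivative_eq_intros)
  then have dp: "deriv p z = \<gamma> z * (1 + z * deriv \<gamma> z / \<gamma> z)"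
    using nz by (simp add: DERIV_imp_deriv field_simps)
  define Q where "Q = 1 + z * deriv \<gamma> z / \<gamma> z"
  have "deriv q (p z) = inverse (\<gamma> z * Q)"
    using q(2)[OF z] dp unfolding Q_def by (metis inverse_unique mult.commute)
  then have "D = (cnj z * z) * inverse Q"
    using nz by (simp add: D_def p_def)
  also have "\<dots> = of_real ((norm z)\<^sup>2) * inverse Q"
    by (metis complex_norm_square mult.commute)
  finally have "Re D = (norm z)\<^sup>2 * Re (inverse Q)" by simp
  with \<open>Re D \<ge> 0\<close> have "(norm z)\<^sup>2 * 0 \<le> (norm z)\<^sup>2 * Re (inverse Q)" by simp
  then have "Re (inverse Q) \<ge> 0"
    by (rule mult_left_le_imp_le) (use False in simp)
  then have "Re Q \<ge> 0"
    by (simp add: zero_le_divide_iff) (smt (verit) sum_power2_gt_zero_iff sum_power2_ge_zero zero_eq_power2 power2_less_0)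
  then show ?thesis by (simp add: Q_def)
qed auto

text \<open>By the open mapping theorem a value on the imaginary axis has values of negative real
  part next to it, unless \<open>Q\<close> is constant, which \<open>Re (Q 0) > 0\<close>
  excludes.\<close>

lemma Re_pos_of_Re_nonneg:
  assumes "Q holomorphic_on ball 0 1" "Re (Q 0) > 0"
    and nn: "\<And>z. z \<in> ball 0 1 \<Longrightarrow> Re (Q z) \<ge> 0" and z: "z \<in> ball 0 1"
  shows "Re (Q z) > 0"
proof (rule ccontr)
  assume "\<not> Re (Q z) > 0"
  then have 0: "Re (Q z) = 0" using nn[OF z] by simp
  have "\<not> Q constant_on ball 0 1"
  proof
    assume "Q constant_on ball 0 1"
    then have "Q z = Q 0" using z unfolding constant_on_def by auto
    then show False using 0 assms(2) by simp
  qed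
  then have "open (Q ` ball 0 1)"
    using open_mapping_thm[OF assms(1) open_ball connected_ball open_ball] by blast
  then obtain e where e: "e > 0" "ball (Q z) e \<subseteq> Q ` ball 0 1"
    using z openE by blast
  have "Q z - of_real (e / 2) \<in> ball (Q z) e" using e(1) by (simp add: dist_norm)
  then obtain w where "w \<in> ball 0 1" "Q z - of_real (e / 2) = Q w" using e(2) by blast
  then have "Re (Q z) - e / 2 \<ge> 0"
    using nn[of w] by (metis Re_complex_of_real minus_complex.simps(1))
  then show False using 0 e(1) by simp
qed

lemma starlike_imp_Re_pos:
  assumes hol: "\<gamma> holomorphic_on ball 0 1" and nz: "\<And>z. z \<in> ball 0 1 \<Longrightarrow> \<gamma> z \<noteq> 0"
    and inj: "inj_on (\<lambda>z. z * \<gamma> z) (ball 0 1)"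
    and star: "\<And>z t. z \<in> ball 0 1 \<Longrightarrow> 0 \<le> t \<Longrightarrow> t \<le> 1 \<Longrightarrow>
      \<exists>w\<in>ball 0 1. w * \<gamma> w = complex_of_real t * (z * \<gamma> z)"
    and z: "z \<in> ball 0 1"
  shows "Re (1 + z * deriv \<gamma> z / \<gamma> z) > 0"
proof (rule Re_pos_of_Re_nonneg[OF _ _ _ z, where Q = "\<lambda>z. 1 + z * deriv \<gamma> z / \<gamma> z"])
  show "(\<lambda>z. 1 + z * deriv \<gamma> z / \<gamma> z) holomorphic_on ball 0 1"
    using nz by (intro holomorphic_intros hol) auto
qed (use starlike_imp_Re_nonneg[OF hol nz inj star] in auto)

text \<open>The Noshiro-Warschawski argument: the mean value theorem for the real part of
  \<open>\<Phi> / (b - a)\<close> along the segment from \<open>a\<close> to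
  \<open>b\<close>.\<close>

lemma Re_difference_quotient_pos:
  assumes "convex S" and d: "\<And>z. z \<in> S \<Longrightarrow> (\<Phi> has_field_derivative \<Phi>' z) (at z)"
    and pos: "\<And>z. z \<in> S \<Longrightarrow> Re (\<Phi>' z) > 0" and ab: "a \<in> S" "b \<in> S" "a \<noteq> b"
  shows "Re ((\<Phi> b - \<Phi> a) / (b - a)) > 0"
proof -
  define u where "u t = Re (\<Phi> (a + complex_of_real t * (b - a)) / (b - a))" for t
  have seg: "a + complex_of_real t * (b - a) \<in> S" if "0 \<le> t" "t \<le> 1" for t
  proof -
    have "a + complex_of_real t * (b - a) = (1 - t) *\<^sub>R a + t *\<^sub>R b"
      by (simp add: scaleR_conv_of_real algebra_simps)
    then show ?thesis using convexD_alt[OF \<open>convex S\<close> ab(1,2) that] by simp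
  qed
  have du: "(u has_real_derivative Re (\<Phi>' (a + complex_of_real t * (b - a)))) (at t)"
    if "0 \<le> t" "t \<le> 1" for t
  proof -
    have "((\<lambda>s. \<Phi> (a + s * (b - a)) / (b - a)) has_field_derivative
        \<Phi>' (a + complex_of_real t * (b - a)) * (b - a) / (b - a)) (at (of_real t))"
      by (intro DERIV_cdivide DERIV_chain2[where f = \<Phi> and g = "\<lambda>s. a + s * (b - a)"] d seg that)
        (auto intro!: derivative_eq_intros)
    from has_real_derivative_Re_of_real[OF this] show ?thesis
      using ab(3) by (simp add: u_def[abs_def])
  qed
  obtain t where t: "0 < t" "t < 1" "u 1 - u 0 = (1 - 0) * Re (\<Phi>' (a + complex_of_real t * (b - a)))"
    using MVT2[of 0 1 u "\<lambda>t. Re (\<Phi>' (a + complex_of_real t * (b - a)))"] du by auto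
  then have "u 1 - u 0 > 0" using pos seg[of t] by simp
  then show ?thesis by (simp add: u_def diff_divide_distrib)
qed

text \<open>In the logarithmic coordinate \<open>s\<close>, \<open>z = e\<^sup>s\<close>, the map \<open>z \<mapsto> z \<gamma>(z)\<close> becomes
  \<open>\<Phi>(s) = s + log \<gamma>(e\<^sup>s)\<close>, whose derivative has positive real part on the left half plane.\<close>

lemma Re_pos_imp_norm_le:
  assumes hol: "\<gamma> holomorphic_on ball 0 1" and nz: "\<And>z. z \<in> ball 0 1 \<Longrightarrow> \<gamma> z \<noteq> 0"
    and pos: "\<And>z. z \<in> ball 0 1 \<Longrightarrow> Re (1 + z * deriv \<gamma> z / \<gamma> z) > 0"
    and z0: "z0 \<in> ball 0 1" and z1: "z1 \<in> ball 0 1" and t: "0 < t" "t \<le> 1"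
    and eq: "z1 * \<gamma> z1 = complex_of_real t * (z0 * \<gamma> z0)"
  shows "norm z1 \<le> norm z0" and "t = 1 \<Longrightarrow> z1 = z0"
proof -
  have "norm z1 \<le> norm z0 \<and> (t = 1 \<longrightarrow> z1 = z0)"
  proof (cases "z0 = 0 \<or> z1 = 0")
    case True
    then have "z0 = 0 \<and> z1 = 0" using eq nz[OF z0] nz[OF z1] t by auto
    then show ?thesis by simp
  next
    case False
    obtain \<phi> where \<phi>: "\<phi> holomorphic_on ball 0 1" "\<And>z. z \<in> ball 0 1 \<Longrightarrow> exp (\<phi> z) = \<gamma> z"
      using holomorphic_logarithm_exists[OF convex_ball open_ball hol, of 0] nz by (metis centre_in_ball zero_less_one)
    define H where "H = {s. Re s < 0}"
    define \<Phi> where "\<Phi> s = s + \<phi> (exp s)" for s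
    have expD: "exp s \<in> ball 0 1" if "s \<in> H" for s :: complex
      using that by (simp add: H_def)
    have d\<phi>: "(\<phi> has_field_derivative deriv \<gamma> z / \<gamma> z) (at z)" if z: "z \<in> ball 0 1" for z
    proof -
      have 1: "(\<phi> has_field_derivative deriv \<phi> z) (at z)"
        by (rule holomorphic_derivI[OF \<phi>(1) open_ball z])
      then have "((\<lambda>z. exp (\<phi> z)) has_field_derivative exp (\<phi> z) * deriv \<phi> z) (at z)"
        by (auto intro!: derivative_eq_intros)
      then have "(\<gamma> has_field_derivative exp (\<phi> z) * deriv \<phi> z) (at z)"
        by (rule has_field_derivative_transform_within_open[OF _ open_ball z \<phi>(2)])
      then have "deriv \<gamma> z = \<gamma> z * deriv \<phi> z" using \<phi>(2)[OF z] DERIV_imp_deriv by metis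
      then show ?thesis using 1 nz[OF z] by simp
    qed
    have d\<Phi>: "(\<Phi> has_field_derivative 1 + exp s * deriv \<gamma> (exp s) / \<gamma> (exp s)) (at s)"
      if "s \<in> H" for s
      unfolding \<Phi>_def
      by (auto intro!: derivative_eq_intros DERIV_chain2[where f = \<phi> and g = exp] d\<phi> expD[OF that])
    have conv: "convex H" unfolding H_def by (rule convex_halfspace_Re_lt)
    have exp\<Phi>: "exp (\<Phi> s) = exp s * \<gamma> (exp s)" if "s \<in> H" for s
      using \<phi>(2)[OF expD[OF that]] by (simp add: \<Phi>_def exp_add)
    define s0 where "s0 = Ln z0"
    define s1 where "s1 = Ln z1"
    have s: "exp s0 = z0" "exp s1 = z1" "s0 \<in> H" "s1 \<in> H"
      using False z0 z1 by (auto simp: s0_def s1_def H_def)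
    have "exp (\<Phi> s1) = exp (\<Phi> s0 + of_real (ln t))"
      using exp\<Phi>[OF s(3)] exp\<Phi>[OF s(4)] s eq t by (simp add: exp_add exp_of_real)
    then obtain n :: int where n: "\<Phi> s1 = \<Phi> s0 + of_real (ln t) + of_int (2 * n) * pi * \<i>"
      unfolding exp_eq by auto
    \<comment> \<open>\<open>\<Phi>(s) - s\<close> has period \<open>2 pi i\<close>, so moving
      \<open>s0\<close> by a period absorbs the ambiguity of the logarithm and leaves the real
      difference \<open>ln t\<close>.\<close>
    define s' where "s' = s0 + of_int (2 * n) * pi * \<i>"
    have "exp s' = exp s0" unfolding exp_eq s'_def by blast
    then have s': "exp s' = z0" "s' \<in> H" "\<Phi> s1 - \<Phi> s' = of_real (ln t)"
      using s n by (auto simp: \<Phi>_def s'_def H_def)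
    show ?thesis
    proof (cases "s1 = s'")
      case True
      then show ?thesis using s s' by simp
    next
      case False
      then have "Re ((\<Phi> s1 - \<Phi> s') / (s1 - s')) > 0"
        using Re_difference_quotient_pos[OF conv d\<Phi> pos[OF expD] s'(2) s(4)] by auto
      \<comment> \<open>Since \<open>ln t\<close> is real, the quotient has the sign of
        \<open>ln t * Re (s1 - s')\<close> as real part. Positivity excludes \<open>t = 1\<close> in
        this case, and for \<open>t < 1\<close> it gives \<open>Re s1 < Re s'\<close>, that is,
        \<open>norm z1 < norm z0\<close>.\<close>
      moreover have "Re ((\<Phi> s1 - \<Phi> s') / (s1 - s')) = ln t * Re (s1 - s') / (norm (s1 - s'))\<^sup>2"
        unfolding s'(3) by (simp add: Re_divide cmod_power2)
      ultimately have "ln t * Re (s1 - s') > 0"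
        by (simp add: zero_less_divide_iff)
      then have "t \<noteq> 1" "Re (s1 - s') < 0"
        using t by (auto simp: zero_less_mult_iff)
      moreover have "norm z1 = exp (Re s1)" "norm z0 = exp (Re s')"
        using s s' by (metis norm_exp_eq_Re)+
      ultimately show ?thesis by simp
    qed
  qed
  then show "norm z1 \<le> norm z0" "t = 1 \<Longrightarrow> z1 = z0" by auto
qed

text \<open>The second claim is a connectedness argument on \<open>{0..1}\<close>: the set of
  \<open>t\<close> for which \<open>t p(z0)\<close> is attained is open because the image is open,
  and closed because the norm bound confines preimages to the compact disc of radius
  \<open>norm z0\<close>.\<close>

lemma Re_pos_imp_starlike:
  assumes hol: "\<gamma> holomorphic_on ball 0 1" and nz: "\<And>z. z \<in> ball 0 1 \<Longrightarrow> \<gamma> z \<noteq> 0"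
    and pos: "\<And>z. z \<in> ball 0 1 \<Longrightarrow> Re (1 + z * deriv \<gamma> z / \<gamma> z) > 0"
  shows "inj_on (\<lambda>z. z * \<gamma> z) (ball 0 1)"
    and "z0 \<in> ball 0 1 \<Longrightarrow> 0 \<le> t \<Longrightarrow> t \<le> 1 \<Longrightarrow>
      \<exists>w\<in>ball 0 1. w * \<gamma> w = complex_of_real t * (z0 * \<gamma> z0)"
proof -
  let ?p = "\<lambda>z. z * \<gamma> z"
  show inj: "inj_on ?p (ball 0 1)"
    using Re_pos_imp_norm_le(2)[OF hol nz pos, where t = 1] by (intro inj_onI) auto
  have hp: "?p holomorphic_on ball 0 1" by (intro holomorphic_intros hol)
  have op: "open (?p ` ball 0 1)"
    by (rule open_mapping_thm3[OF hp open_ball inj])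
  assume z0: "z0 \<in> ball 0 1" and t: "0 \<le> t" "t \<le> 1"
  let ?l = "\<lambda>t. complex_of_real t * ?p z0"
  have contl: "continuous_on A ?l" for A by (intro continuous_intros)
  have sub: "cball 0 (norm z0) \<subseteq> ball (0::complex) 1" using z0 by auto
  have "compact (?p ` cball 0 (norm z0))"
    using holomorphic_on_imp_continuous_on[OF hp] sub
    by (intro compact_continuous_image compact_cball) (rule continuous_on_subset)
  then have cl: "closed (?p ` cball 0 (norm z0))" by (rule compact_imp_closed)
  define A where "A = {t \<in> {0..1}. ?l t \<in> ?p ` ball 0 1}"
  have A': "A = {t \<in> {0..1}. ?l t \<in> ?p ` cball 0 (norm z0)}"
  proof -
    have "?l t \<in> ?p ` cball 0 (norm z0)" if t: "t \<in> {0..1}" and l: "?l t \<in> ?p ` ball 0 1" for t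
    proof -
      obtain w where w: "w \<in> ball 0 1" "?l t = ?p w" using l by blast
      show ?thesis
      proof (cases "t = 0")
        case True
        then show ?thesis by (auto intro!: image_eqI[where x = 0])
      next
        case False
        then have "norm w \<le> norm z0"
          using Re_pos_imp_norm_le(1)[OF hol nz pos z0 w(1), of t] w(2) t by auto
        then show ?thesis using w by auto
      qed
    qed
    then show ?thesis unfolding A_def using sub by blast
  qed
  have "openin (top_of_set {0..1}) A"
  proof -
    have "A = {0..1} \<inter> ?l -` (?p ` ball 0 1)" unfolding A_def by blast
    then show ?thesis using continuous_openin_preimage_gen[OF contl op] by metis
  qed
  moreover have "closedin (top_of_set {0..1}) A"
  proof -
    have "A = {0..1} \<inter> ?l -` (?p ` cball 0 (norm z0))" unfolding A' by blast
    then show ?thesis using continuous_closedin_preimage[OF contl cl] by metis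
  qed
  moreover have "0 \<in> A" unfolding A_def by (auto intro!: image_eqI[where x = 0])
  ultimately have "A = {0..1}"
    using connected_clopen[of "{0..1::real}"] connected_Icc by blast
  then have "?l t \<in> ?p ` ball 0 1" using t unfolding A_def by auto
  then show "\<exists>w\<in>ball 0 1. w * \<gamma> w = complex_of_real t * (z0 * \<gamma> z0)" by auto
qed

text \<open>A relative of Jack's lemma in a logarithmic coordinate. No direction \<open>d\<close>
  into the left half plane can lower \<open>Re H\<close> below its value 0 at the origin, so
  \<open>Re (m * d) \<ge> 0\<close> whenever \<open>Re d < 0\<close>; this forces \<open>m\<close>
  to be real and nonpositive.\<close>

lemma derivative_at_first_zero_of_Re:
  assumes d: "(H has_field_derivative m) (at 0)"
    and pos: "\<And>s. Re s < 0 \<Longrightarrow> Re (H s) > 0" and "Re (H 0) \<le> 0"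
  shows "Re (H 0) = 0" "Im m = 0" "Re m \<le> 0"
proof -
  have dd: "((\<lambda>t. Re (H (of_real t * d))) has_real_derivative Re (m * d)) (at 0)" for d
  proof -
    have "((\<lambda>s. H (s * d)) has_field_derivative m * d) (at (of_real 0))"
      by (rule DERIV_chain2[where f = H and g = "\<lambda>s. s * d"])
        (use d in \<open>auto intro!: derivative_eq_intros\<close>)
    from has_real_derivative_Re_of_real[OF this] show ?thesis by simp
  qed
  have p: "Re (H (of_real t * d)) > 0" if "t > 0" "Re d < 0" for t d
    using that by (intro pos) (simp add: mult_pos_neg)
  have "isCont (\<lambda>t. Re (H (of_real t * (-1)))) 0"
    using dd[of "-1"] DERIV_isCont by blast
  then have "((\<lambda>t. Re (H (of_real t * (-1)))) \<longlongrightarrow> Re (H 0)) (at_right 0)"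
    unfolding isCont_def by (auto intro: tendsto_mono[OF at_le])
  then have "Re (H 0) \<ge> 0"
    by (rule tendsto_lowerbound)
      (auto simp: eventually_at_filter less_imp_le[OF p[where d = "-1", simplified]] intro!: always_eventually)
  then show 0: "Re (H 0) = 0" using assms(3) by simp
  have ge: "Re (m * d) \<ge> 0" if "Re d < 0" for d
  proof (rule ccontr)
    assume "\<not> Re (m * d) \<ge> 0"
    then obtain e where e: "e > 0" "\<And>h. h > 0 \<Longrightarrow> h < e \<Longrightarrow> Re (H (of_real (0 + h) * d)) < Re (H (of_real 0 * d))"
      using DERIV_neg_dec_right[OF dd[of d]] by auto
    from e(2)[of "e / 2"] p[of "e / 2" d] 0 e(1) that show False by simp
  qed
  show "Re m \<le> 0" using ge[of "-1"] by simp
  show "Im m = 0"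
  proof (rule ccontr)
    assume "Im m \<noteq> 0"
    \<comment> \<open>This direction \<open>d\<close> is chosen to make
      \<open>Re (m * d) = -1\<close>.\<close>
    then show False using ge[of "Complex (-1) ((1 - Re m) / Im m)"] by simp
  qed
qed

text \<open>The quotient \<open>h = \<phi> / (\<phi> + z \<phi>')\<close> satisfies \<open>h P + z h' = 1\<close>, where \<open>P\<close> has positive
  real part. At a point of least modulus where \<open>Re h = 0\<close>, \<open>z h'\<close> is real and nonpositive, so the
  equation forces \<open>h = 0\<close> and then \<open>z h' = 1\<close>.\<close>

lemma convex_imp_nonvanishing:
  assumes hol: "\<phi> holomorphic_on ball 0 1" and "\<phi> 0 = 1"
    and g: "\<And>z. z \<in> ball 0 1 \<Longrightarrow> g z = \<phi> z + z * deriv \<phi> z"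
    and nz: "\<And>z. z \<in> ball 0 1 \<Longrightarrow> g z \<noteq> 0"
    and pos: "\<And>z. z \<in> ball 0 1 \<Longrightarrow> Re (1 + z * deriv g z / g z) > 0"
    and z: "z \<in> ball 0 1"
  shows "\<phi> z \<noteq> 0"
proof
  assume "\<phi> z = 0"
  have hg: "g holomorphic_on ball 0 1"
    by (rule holomorphic_transform[of "\<lambda>z. \<phi> z + z * deriv \<phi> z"])
      (auto intro!: holomorphic_intros hol simp: g)
  define h where "h z = \<phi> z / g z" for z
  have hh: "h holomorphic_on ball 0 1"
    unfolding h_def using nz by (intro holomorphic_intros hol hg) auto
  define K where "K = {w \<in> cball 0 (norm z). Re (h w) \<le> 0}"
  have sub: "cball 0 (norm z) \<subseteq> ball (0::complex) 1" using z by auto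
  have "continuous_on (cball 0 (norm z)) (\<lambda>w. Re (h w))"
    using holomorphic_on_imp_continuous_on[OF hh] continuous_on_subset[OF _ sub]
    by (intro continuous_intros) auto
  then have "closed K" unfolding K_def by (intro continuous_on_closed_Collect_le) auto
  moreover have "bounded K"
    by (rule bounded_subset[OF bounded_cball[of 0 "norm z"]]) (auto simp: K_def)
  ultimately have "compact K" by (simp add: compact_eq_bounded_closed)
  moreover have "z \<in> K" using \<open>\<phi> z = 0\<close> by (simp add: K_def h_def)
  ultimately obtain z0 where z0: "z0 \<in> K" "\<And>w. w \<in> K \<Longrightarrow> norm z0 \<le> norm w"
    using continuous_attains_inf[of K norm] continuous_on_norm_id by blast
  have z0D: "z0 \<in> ball 0 1" using z0(1) sub by (auto simp: K_def)
  have "z0 \<noteq> 0"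
    using z0(1) g[of 0] \<open>\<phi> 0 = 1\<close> by (auto simp: K_def h_def)
  have less: "Re (h w) > 0" if "norm w < norm z0" for w
    using z0(2)[of w] that z0(1) by (force simp: K_def)
  have dh: "(h has_field_derivative deriv h z0) (at z0)"
    by (rule holomorphic_derivI[OF hh open_ball z0D])
  \<comment> \<open>Under \<open>w = z0 * exp s\<close> the half plane \<open>Re s < 0\<close>
    covers the punctured disc \<open>norm w < norm z0\<close>, where \<open>Re (h w) > 0\<close> by
    minimality of \<open>z0\<close>.\<close>
  have dH: "((\<lambda>s. h (z0 * exp s)) has_field_derivative z0 * deriv h z0) (at 0)"
  proof (rule DERIV_cong[OF DERIV_chain2[where f = h and g = "\<lambda>s. z0 * exp s"]])
    show "(h has_field_derivative deriv h z0) (at (z0 * exp 0))" using dh by simp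
    show "((\<lambda>s. z0 * exp s) has_field_derivative z0 * exp 0) (at 0)"
      by (auto intro!: derivative_eq_intros)
  qed simp
  have "Re (h (z0 * exp s)) > 0" if "Re s < 0" for s
    using that \<open>z0 \<noteq> 0\<close> by (intro less) (simp add: norm_mult)
  moreover have "Re (h (z0 * exp 0)) \<le> 0" using z0(1) by (simp add: K_def)
  ultimately have m: "Re (h z0) = 0" "Im (z0 * deriv h z0) = 0" "Re (z0 * deriv h z0) \<le> 0"
    using derivative_at_first_zero_of_Re[OF dH] by auto
  have d\<phi>: "(\<phi> has_field_derivative deriv \<phi> z0) (at z0)"
    by (rule holomorphic_derivI[OF hol open_ball z0D])
  have dg: "(g has_field_derivative deriv g z0) (at z0)"
    by (rule holomorphic_derivI[OF hg open_ball z0D])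
  have h': "deriv h z0 = (deriv \<phi> z0 * g z0 - \<phi> z0 * deriv g z0) / (g z0 * g z0)"
    unfolding h_def using DERIV_imp_deriv[OF DERIV_divide[OF d\<phi> dg nz[OF z0D]]] .
  \<comment> \<open>The source of this identity is \<open>\<phi> = h * g\<close>: differentiate,
    multiply by \<open>z\<close>, add \<open>\<phi>\<close> and divide by \<open>g\<close>.\<close>
  then have "h z0 * (1 + z0 * deriv g z0 / g z0) + z0 * deriv h z0 =
      (\<phi> z0 + z0 * deriv \<phi> z0) / g z0"
    unfolding h' h_def using nz[OF z0D] by (simp add: field_simps)
  then have eq: "h z0 * (1 + z0 * deriv g z0 / g z0) + z0 * deriv h z0 = 1"
    using g[OF z0D] nz[OF z0D] by simp
  define P where "P = 1 + z0 * deriv g z0 / g z0"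
  define n where "n = z0 * deriv h z0"
  have "Re P > 0" using pos[OF z0D] by (simp add: P_def)
  have eq': "h z0 * P + n = 1" using eq by (simp add: P_def n_def)
  have "Im (h z0) * Re P = 0"
    using arg_cong[OF eq', of Im] m by (simp add: n_def[symmetric])
  then have "Im (h z0) = 0" using \<open>Re P > 0\<close> by simp
  then show False
    using arg_cong[OF eq', of Re] m by (simp add: n_def[symmetric])
qed

section \<open>Existence of support functionals\<close>

text \<open>Homogeneity is asked only as an inequality for \<open>r > 0\<close>, the form that
  infima inherit directly; equality and \<open>p 0 = 0\<close> follow by using \<open>1 / r\<close>
  as well.\<close>

definition sublinear :: "('a::real_vector \<Rightarrow> real) \<Rightarrow> bool"
  where "sublinear p \<longleftrightarrow> (\<forall>x y. p (x + y) \<le> p x + p y) \<and> (\<forall>r x. 0 < r \<longrightarrow> p (r *\<^sub>R x) \<le> r * p x)"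

lemma sublinear_add: "sublinear p \<Longrightarrow> p (x + y) \<le> p x + p y"
  by (simp add: sublinear_def)

lemma sublinear_scaleR_le: "sublinear p \<Longrightarrow> 0 < r \<Longrightarrow> p (r *\<^sub>R x) \<le> r * p x"
  by (simp add: sublinear_def)

lemma sublinear_zero: "sublinear p \<Longrightarrow> p 0 = 0"
  using sublinear_scaleR_le[of p 2 0] sublinear_scaleR_le[of p "1 / 2" 0] by simp

lemma sublinear_scaleR:
  assumes "sublinear p" "0 < r"
  shows "p (r *\<^sub>R x) = r * p x"
proof (rule antisym)
  have "p x \<le> inverse r * p (r *\<^sub>R x)"
    using sublinear_scaleR_le[of p "inverse r" "r *\<^sub>R x"] assms by simp
  then show "r * p x \<le> p (r *\<^sub>R x)" using \<open>0 < r\<close> by (simp add: field_simps)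
qed (rule sublinear_scaleR_le[OF assms])

lemma sublinear_minus: "sublinear p \<Longrightarrow> - p (- x) \<le> p x"
  using sublinear_add[of p x "- x"] sublinear_zero[of p] by simp

text \<open>This is the Hahn-Banach theorem without an extension step: \<open>directional_inf p a\<close> is sublinear, lies
  below \<open>p\<close> and is sharp in the direction \<open>a\<close>, so a minimal sublinear functional is additive.\<close>

definition directional_inf :: "('a::real_vector \<Rightarrow> real) \<Rightarrow> 'a \<Rightarrow> 'a \<Rightarrow> real"
  where "directional_inf p a x = (INF t\<in>{0..}. p (x + t *\<^sub>R a) - t * p a)"

context
  fixes p :: "'a::real_vector \<Rightarrow> real"
  assumes p: "sublinear p"
begin

lemma directional_inf_bdd: "bdd_below ((\<lambda>t. p (x + t *\<^sub>R a) - t * p a) ` {0..})"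
proof (rule bdd_belowI2)
  fix t :: real assume "t \<in> {0..}"
  then have "t * p a = p (t *\<^sub>R a)"
    using sublinear_scaleR[OF p, of t a] sublinear_zero[OF p] by (cases "t = 0") auto
  also have "\<dots> \<le> p (x + t *\<^sub>R a) + p (- x)"
    using sublinear_add[OF p, of "x + t *\<^sub>R a" "- x"] by simp
  finally show "- p (- x) \<le> p (x + t *\<^sub>R a) - t * p a" by simp
qed

lemma directional_inf_le: "0 \<le> t \<Longrightarrow> directional_inf p a x \<le> p (x + t *\<^sub>R a) - t * p a"
  unfolding directional_inf_def by (rule cINF_lower[OF directional_inf_bdd]) simp

lemma directional_inf_greatest:
  "(\<And>t. 0 \<le> t \<Longrightarrow> c \<le> p (x + t *\<^sub>R a) - t * p a) \<Longrightarrow> c \<le> directional_inf p a x"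
  unfolding directional_inf_def by (rule cINF_greatest) auto

text \<open>The parameter follows the vector: \<open>s + t\<close> serves \<open>x + y\<close>, and
  \<open>r * t\<close> serves \<open>r *\<^sub>R x\<close>.\<close>

lemma sublinear_directional_inf: "sublinear (directional_inf p a)"
  unfolding sublinear_def
proof (intro conjI allI impI)
  fix x y
  have *: "directional_inf p a (x + y) \<le> (p (x + s *\<^sub>R a) - s * p a) + (p (y + t *\<^sub>R a) - t * p a)"
    if "0 \<le> s" "0 \<le> t" for s t
    using directional_inf_le[of "s + t" a "x + y"] sublinear_add[OF p, of "x + s *\<^sub>R a" "y + t *\<^sub>R a"] that
    by (simp add: algebra_simps)
  have "directional_inf p a (x + y) - (p (y + t *\<^sub>R a) - t * p a) \<le> directional_inf p a x" if "0 \<le> t" for t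
    by (rule directional_inf_greatest) (use *[OF _ that] in \<open>simp add: algebra_simps\<close>)
  then have "directional_inf p a (x + y) - directional_inf p a x \<le> directional_inf p a y"
    by (intro directional_inf_greatest) (simp add: algebra_simps)
  then show "directional_inf p a (x + y) \<le> directional_inf p a x + directional_inf p a y" by simp
next
  fix r :: real and x assume "0 < r"
  have "directional_inf p a (r *\<^sub>R x) / r \<le> directional_inf p a x"
  proof (rule directional_inf_greatest)
    fix t :: real assume "0 \<le> t"
    then have "directional_inf p a (r *\<^sub>R x) \<le> p (r *\<^sub>R (x + t *\<^sub>R a)) - (r * t) * p a"
      using directional_inf_le[of "r * t" a "r *\<^sub>R x"] \<open>0 < r\<close> by (simp add: scaleR_add_right)
    also have "\<dots> = r * (p (x + t *\<^sub>R a) - t * p a)"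
      unfolding sublinear_scaleR[OF p \<open>0 < r\<close>] by (simp add: algebra_simps)
    finally show "directional_inf p a (r *\<^sub>R x) / r \<le> p (x + t *\<^sub>R a) - t * p a"
      using \<open>0 < r\<close> by (simp add: field_simps)
  qed
  then show "directional_inf p a (r *\<^sub>R x) \<le> r * directional_inf p a x"
    using \<open>0 < r\<close> by (simp add: field_simps)
qed

text \<open>Zorn's lemma in the reversed order. The pointwise infimum of a chain is finite since
  \<open>- p (- x) \<le> q x\<close>, and subadditive since of two members of a chain one lies below
  both.\<close>

lemma exists_minimal_sublinear:
  "\<exists>m. sublinear m \<and> m \<le> p \<and> (\<forall>q. sublinear q \<longrightarrow> q \<le> m \<longrightarrow> q = m)"
proof -
  define A where "A = {q. sublinear q \<and> q \<le> p}"
  have "\<exists>m\<in>A. \<forall>q\<in>A. q \<le> m \<longrightarrow> q = m"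
  proof (rule predicate_Zorn[where P = "\<lambda>p q. q \<le> p"])
    show "partial_order_on A (relation_of (\<lambda>p q. q \<le> p) A)"
      by (rule partial_order_on_relation_ofI) auto
    fix C assume C: "C \<in> Chains (relation_of (\<lambda>p q. q \<le> p) A)"
    then have CA: "q \<in> A" if "q \<in> C" for q
      using that unfolding Chains_def relation_of_def by blast
    have chain: "q \<le> q' \<or> q' \<le> q" if "q \<in> C" "q' \<in> C" for q q'
      using that C unfolding Chains_def relation_of_def by blast
    show "\<exists>u\<in>A. \<forall>a\<in>C. u \<le> a"
    proof (cases "C = {}")
      case True
      then show ?thesis using p by (auto simp: A_def)
    next
      case False
      define u where "u x = (INF q\<in>C. q x)" for x
      have bdd: "bdd_below ((\<lambda>q. q x) ` C)" for x
      proof (rule bdd_belowI2)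
        fix q assume "q \<in> C"
        then have "sublinear q" "q (- x) \<le> p (- x)" using CA by (auto simp: A_def le_fun_def)
        then show "- p (- x) \<le> q x" using sublinear_minus[of q x] by simp
      qed
      have lower: "u x \<le> q x" if "q \<in> C" for q x
        unfolding u_def by (rule cINF_lower[OF bdd that])
      have greatest: "c \<le> u x" if "\<And>q. q \<in> C \<Longrightarrow> c \<le> q x" for c x
        unfolding u_def using False that by (rule cINF_greatest)
      have "sublinear u"
        unfolding sublinear_def
      proof (intro conjI allI impI)
        fix x y
        have *: "u (x + y) \<le> q x + q' y" if q: "q \<in> C" "q' \<in> C" for q q'
        proof -
          obtain m where m: "m \<in> C" "m \<le> q" "m \<le> q'" using chain[OF q] q by blast
          have "u (x + y) \<le> m (x + y)" by (rule lower[OF m(1)])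
          also have "\<dots> \<le> m x + m y" using CA[OF m(1)] by (auto simp: A_def intro: sublinear_add)
          also have "\<dots> \<le> q x + q' y" using m by (intro add_mono) (auto simp: le_fun_def)
          finally show ?thesis .
        qed
        have "u (x + y) - q' y \<le> u x" if "q' \<in> C" for q'
          by (rule greatest) (use *[OF _ that] in \<open>simp add: algebra_simps\<close>)
        then have "u (x + y) - u x \<le> u y"
          by (intro greatest) (simp add: algebra_simps)
        then show "u (x + y) \<le> u x + u y" by simp
      next
        fix r :: real and x assume r: "0 < r"
        have "u (r *\<^sub>R x) / r \<le> u x"
        proof (rule greatest)
          fix q assume q: "q \<in> C"
          then have "q (r *\<^sub>R x) \<le> r * q x"
            using CA[OF q] r by (auto simp: A_def intro: sublinear_scaleR_le)
          then show "u (r *\<^sub>R x) / r \<le> q x"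
            using lower[OF q, of "r *\<^sub>R x"] r by (simp add: field_simps)
        qed
        then show "u (r *\<^sub>R x) \<le> r * u x" using r by (simp add: field_simps)
      qed
      moreover have "u \<le> p"
      proof -
        obtain q where "q \<in> C" using False by blast
        then have "u \<le> q" "q \<le> p" using lower CA by (auto simp: le_fun_def A_def)
        then show ?thesis by (rule order_trans)
      qed
      ultimately show ?thesis using lower by (auto simp: A_def le_fun_def)
    qed
  qed
  then obtain m where m: "m \<in> A" "\<And>q. q \<in> A \<Longrightarrow> q \<le> m \<Longrightarrow> q = m" by blast
  have "q = m" if "sublinear q" "q \<le> m" for q
    using that m(1) by (intro m(2)) (auto simp: A_def intro: order_trans)
  then show ?thesis using m(1) by (auto simp: A_def)
qed

text \<open>Taking \<open>t = 0\<close> shows \<open>directional_inf p a \<le> p\<close>, so by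
  minimality they agree; then \<open>t = 1\<close> gives
  \<open>p x + p a \<le> p (x + a)\<close>.\<close>

lemma minimal_sublinear_linear:
  assumes min: "\<And>q. sublinear q \<Longrightarrow> q \<le> p \<Longrightarrow> q = p"
  shows "linear p"
proof
  show add: "p (x + a) = p x + p a" for x a
  proof -
    have "directional_inf p a \<le> p"
      using directional_inf_le[of 0] by (auto simp: le_fun_def)
    then have "directional_inf p a = p"
      by (rule min[OF sublinear_directional_inf])
    then have "p x \<le> p (x + a) - p a"
      using directional_inf_le[of 1 a x] by simp
    then show ?thesis
      using sublinear_add[OF p, of x a] by simp
  qed
  fix r :: real and x
  consider "r > 0" | "r = 0" | "- r > 0" by linarith
  then show "p (r *\<^sub>R x) = r *\<^sub>R p x"
  proof cases
    case 3
    have "p (r *\<^sub>R x) + p ((- r) *\<^sub>R x) = 0"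
      using add[of "r *\<^sub>R x" "(- r) *\<^sub>R x"] sublinear_zero[OF p] by simp
    then show ?thesis using sublinear_scaleR[OF p 3, of x] by simp
  qed (use sublinear_scaleR[OF p] sublinear_zero[OF p] in auto)
qed

end

text \<open>The minimal functional is taken below \<open>directional_inf norm x0\<close> instead of
  the norm: at \<open>- x0\<close>, the parameter \<open>t = 1\<close> bounds it by
  \<open>- norm x0\<close>, which forces \<open>l x0 = norm x0\<close>.\<close>

lemma exists_real_support_functional:
  fixes x0 :: "'a::real_normed_vector"
  obtains l where "linear l" "\<And>x. l x \<le> norm x" "l x0 = norm x0"
proof -
  have n: "sublinear (norm :: 'a \<Rightarrow> real)"
    by (simp add: sublinear_def norm_triangle_ineq)
  obtain l where l: "sublinear l" "l \<le> directional_inf norm x0"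
      "\<And>q. sublinear q \<Longrightarrow> q \<le> l \<Longrightarrow> q = l"
    using exists_minimal_sublinear[OF sublinear_directional_inf[OF n]] by metis
  have lin: "linear l" by (rule minimal_sublinear_linear[OF l(1,3)])
  have le: "l x \<le> norm x" for x
    using l(2) directional_inf_le[OF n, of 0 x0 x] by (simp add: le_fun_def) (meson order_trans)
  have "l (- x0) \<le> - norm x0"
    using l(2) directional_inf_le[OF n, of 1 x0 "- x0"] by (simp add: le_fun_def) (metis order_trans)
  then have "l x0 = norm x0" using le[of x0] by (simp add: linear_neg[OF lin])
  with lin le show thesis by (rule that)
qed

text \<open>This keeps the quasi-convexity condition at \<open>x0\<close> from being vacuous. The
  real functional is complexified as \<open>L(x) = l(x) - i l(i x)\<close>, the only complex-linear
  map with real part \<open>l\<close>.\<close>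

lemma support_functionals_nonempty:
  fixes x0 :: "'a::complex_normed_vector"
  assumes "x0 \<noteq> 0"
  shows "support_functionals x0 \<noteq> {}"
proof -
  obtain l where l: "linear l" "\<And>x. l x \<le> norm x" "l x0 = norm x0"
    using exists_real_support_functional[of x0] by metis
  define L where "L x = Complex (l x) (- l (\<i> *\<^sub>C x))" for x :: 'a
  have add: "L (x + y) = L x + L y" for x y
    by (simp add: L_def complex_eq_iff linear_add[OF l(1)] scaleC_add_right)
  have hom: "L (c *\<^sub>C x) = c * L x" for c x
  proof -
    have c: "c *\<^sub>C x = Re c *\<^sub>R x + Im c *\<^sub>R (\<i> *\<^sub>C x)"
      by (subst complex_eq[of c]) (simp add: scaleC_add_left scaleC_of_real mult.commute[of \<i>] flip: scaleC_scaleC)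
    have "\<i> *\<^sub>C (c *\<^sub>C x) = Re c *\<^sub>R (\<i> *\<^sub>C x) - Im c *\<^sub>R x"
      unfolding c by (simp add: scaleC_add_right scaleC.scaleR_right scaleC_scaleC scaleC.minus_left)
    then have "l (\<i> *\<^sub>C (c *\<^sub>C x)) = Re c * l (\<i> *\<^sub>C x) - Im c * l x"
      by (simp add: linear_diff[OF l(1)] linear_scale[OF l(1)])
    moreover have "l (c *\<^sub>C x) = Re c * l x + Im c * l (\<i> *\<^sub>C x)"
      unfolding c by (simp add: linear_add[OF l(1)] linear_scale[OF l(1)])
    ultimately show ?thesis
      by (simp add: L_def complex_eq_iff)
  qed
  have bound: "norm (L x) \<le> norm x" for x
  proof (cases "L x = 0")
    case False
    \<comment> \<open>The unimodular \<open>w\<close> rotates \<open>L x\<close> onto its modulus,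
      so the real bound on \<open>l\<close> applies to \<open>norm (L x)\<close>.\<close>
    define w where "w = cnj (L x) / norm (L x)"
    have w: "norm w = 1" using False by (simp add: w_def norm_divide)
    have "L (w *\<^sub>C x) = norm (L x)"
      unfolding hom w_def using False
      by (simp add: complex_norm_square[symmetric] mult.commute power2_eq_square)
    then have "norm (L x) = l (w *\<^sub>C x)" by (simp add: L_def complex_eq_iff)
    also have "\<dots> \<le> norm x" using l(2)[of "w *\<^sub>C x"] w by (simp add: norm_scaleC)
    finally show ?thesis .
  qed auto
  have bl: "bounded_linear L"
  proof
    show "L (r *\<^sub>R x) = r *\<^sub>R L x" for r x
      using hom[of "complex_of_real r" x] by (simp add: scaleC_of_real scaleR_conv_of_real)
    show "\<exists>K. \<forall>x. norm (L x) \<le> norm x * K" using bound by (intro exI[of _ 1]) simp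
  qed (rule add)
  have "Re (L x0) = norm x0" using l(3) by (simp add: L_def)
  moreover have "Im (L x0) = 0"
  \<comment> \<open>\<open>norm (L x0) \<le> norm x0 = Re (L x0)\<close> leaves no room for an
    imaginary part.\<close>
  proof -
    have "(norm (L x0))\<^sup>2 \<le> (norm x0)\<^sup>2" using bound[of x0] by (intro power_mono) auto
    then show ?thesis using \<open>Re (L x0) = norm x0\<close> by (simp add: cmod_power2)
  qed
  ultimately have x0: "L x0 = of_real (norm x0)" by (simp add: complex_eq_iff)
  have "norm (Blinfun L) = 1"
  proof (rule antisym)
    show "norm (Blinfun L) \<le> 1"
      using bound by (intro norm_blinfun_bound) (auto simp: bounded_linear_Blinfun_apply[OF bl])
    have "norm x0 \<le> norm (Blinfun L) * norm x0"
      using norm_blinfun[of "Blinfun L" x0] by (simp add: bounded_linear_Blinfun_apply[OF bl] x0)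
    then show "1 \<le> norm (Blinfun L)" using assms by simp
  qed
  then have "Blinfun L \<in> support_functionals x0"
    unfolding support_functionals_def
    by (simp add: bounded_linear_Blinfun_apply[OF bl] complex_homogeneous_complex hom x0)
  then show ?thesis by blast
qed

section \<open>Radial multiples of the identity\<close>

text \<open>The preimage of \<open>y\<close> is sought as \<open>c y\<close>; the scalar equation \<open>c g(c y) = 1\<close> is solved near
  \<open>y\<^sub>0\<close> by the minimum modulus principle, so no inverse function theorem is needed.\<close>

lemma radial_multiple_local_inverse:
  fixes g :: "'a::complex_normed_vector \<Rightarrow> complex"
  assumes g: "holomorphic_map_on g U" and "open U"
    and nz: "\<And>x. x \<in> U \<Longrightarrow> g x \<noteq> 0"
    and inj: "inj_on (\<lambda>x. g x *\<^sub>C x) U" and x0: "x0 \<in> U" and "0 < e"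
  shows "\<exists>V. open V \<and> g x0 *\<^sub>C x0 \<in> V \<and>
    (\<forall>y\<in>V. \<exists>c. norm (c - inverse (g x0)) < e \<and> c *\<^sub>C y \<in> U \<and> g (c *\<^sub>C y) *\<^sub>C (c *\<^sub>C y) = y)"
proof -
  define c0 where "c0 = inverse (g x0)"
  define y0 where "y0 = g x0 *\<^sub>C x0"
  have c0y0: "c0 *\<^sub>C y0 = x0" using nz[OF x0] by (simp add: c0_def y0_def scaleC_scaleC)
  have contg: "continuous_on U g" by (rule holomorphic_map_on_imp_continuous_on[OF g])
  have cont_smult: "continuous_on A (\<lambda>p. snd p *\<^sub>C fst p)" for A :: "('a \<times> complex) set"
    by (intro scaleC.continuous_on continuous_intros)
  have cont_smult0: "continuous_on A (\<lambda>p. snd p *\<^sub>C y0)" for A :: "('a \<times> complex) set"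
    by (intro scaleC.continuous_on continuous_intros)
  have cont_smult1: "continuous_on A (\<lambda>c. c *\<^sub>C y)" for A and y :: 'a
    by (intro scaleC.continuous_on continuous_intros)
  have "open ((\<lambda>c. c *\<^sub>C y0) -` U)"
    using open_vimage[OF \<open>open U\<close> cont_smult1] .
  then obtain r1 where r1: "r1 > 0" "ball c0 r1 \<subseteq> (\<lambda>c. c *\<^sub>C y0) -` U"
    using x0 c0y0 openE by (metis vimageI)
  define r where "r = min (r1 / 2) e"
  have r: "r > 0" "r \<le> e" "\<And>c. c \<in> cball c0 r \<Longrightarrow> c *\<^sub>C y0 \<in> U"
    using r1 \<open>0 < e\<close> by (auto simp: r_def subset_iff)
  define h where "h y c = c * g (c *\<^sub>C y) - 1" for y c
  have h0: "h y0 c0 = 0" using nz[OF x0] c0y0 by (simp add: h_def c0_def)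
  have uniq: "c = c0" if c: "c \<in> cball c0 r" "h y0 c = 0" for c
  \<comment> \<open>If \<open>y0 = 0\<close>, all \<open>c *\<^sub>C y0\<close> coincide and
    injectivity does not determine \<open>c\<close>; the equation \<open>c * g 0 = 1\<close>
    does.\<close>
  proof (cases "y0 = 0")
    case True
    then have "x0 = 0" using c0y0 by (simp add: scaleC.zero_right)
    then have "c * g x0 = 1" using c(2) True by (simp add: h_def scaleC.zero_right)
    then show ?thesis unfolding c0_def by (metis inverse_unique mult.commute)
  next
    case False
    have "g (c *\<^sub>C y0) *\<^sub>C (c *\<^sub>C y0) = y0"
      using c(2) by (simp add: h_def scaleC_scaleC mult.commute)
    then have "c *\<^sub>C y0 = x0"
      using inj_onD[OF inj _ r(3)[OF c(1)] x0] by (simp add: y0_def)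
    then show ?thesis using False c0y0 by (metis scaleC_cancel_right)
  qed
  have conth: "continuous_on A (h y)" if "\<And>c. c \<in> A \<Longrightarrow> c *\<^sub>C y \<in> U" for A y
    unfolding h_def
    by (intro continuous_intros continuous_on_compose2[OF contg cont_smult1]) (use that in auto)
  have "\<exists>m>0. \<forall>c\<in>sphere c0 r. m \<le> norm (h y0 c)"
  proof -
    have "continuous_on (sphere c0 r) (\<lambda>c. norm (h y0 c))"
      by (intro continuous_intros conth) (use r(3) in auto)
    moreover have "sphere c0 r \<noteq> {}" using r(1) by simp
    ultimately obtain c where c: "c \<in> sphere c0 r" "\<And>c'. c' \<in> sphere c0 r \<Longrightarrow> norm (h y0 c) \<le> norm (h y0 c')"
      using continuous_attains_inf[OF compact_sphere] by metis
    have "h y0 c \<noteq> 0" using uniq[of c] c(1) r(1) by auto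
    then show ?thesis using c(2) by (intro exI[of _ "norm (h y0 c)"]) auto
  qed
  then obtain m where m: "m > 0" "\<And>c. c \<in> sphere c0 r \<Longrightarrow> m \<le> norm (h y0 c)" by blast
  define N where "N = (\<lambda>p. snd p *\<^sub>C fst p) -` U \<inter> (\<lambda>p. snd p *\<^sub>C y0) -` U"
  have "open N" unfolding N_def
    by (intro open_Int open_vimage[OF \<open>open U\<close>] cont_smult cont_smult0)
  \<comment> \<open>\<open>h y\<close> must be close to \<open>h y0\<close> for all \<open>c\<close>
    in the disc at once; compactness of the disc and the tube lemma extract such a neighbourhood of
    \<open>y0\<close> from \<open>W\<close>.\<close>
  define W where "W = N \<inter> (\<lambda>p. norm (h (fst p) (snd p) - h y0 (snd p))) -` {..<m / 2}"
  have "open W"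
    unfolding W_def
  proof (rule continuous_open_preimage[OF _ \<open>open N\<close> open_lessThan])
    show "continuous_on N (\<lambda>p. norm (h (fst p) (snd p) - h y0 (snd p)))"
      unfolding h_def
      by (intro continuous_intros continuous_on_compose2[OF contg cont_smult]
          continuous_on_compose2[OF contg cont_smult0]) (auto simp: N_def)
  qed
  moreover have "{y0} \<times> cball c0 r \<subseteq> W"
    using r(3) m(1) by (auto simp: W_def N_def)
  ultimately obtain V where V: "y0 \<in> V" "open V" "V \<times> cball c0 r \<subseteq> W"
    using Elementary_Topology.tube_lemma[OF compact_cball] by metis
  have "\<exists>c. norm (c - c0) < e \<and> c *\<^sub>C y \<in> U \<and> g (c *\<^sub>C y) *\<^sub>C (c *\<^sub>C y) = y" if y: "y \<in> V" for y
  proof -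
    have W: "c *\<^sub>C y \<in> U" "norm (h y c - h y0 c) < m / 2" if "c \<in> cball c0 r" for c
    proof -
      have "(y, c) \<in> W" using V(3) y that by blast
      then show "c *\<^sub>C y \<in> U" "norm (h y c - h y0 c) < m / 2" by (auto simp: W_def N_def)
    qed
    \<comment> \<open>\<open>norm (h y c)\<close> exceeds \<open>m / 2\<close> on the circle and is
      below \<open>m / 2\<close> at the centre, so there is a zero inside.\<close>
    obtain c where c: "c \<in> ball c0 r" "h y c = 0"
    proof (rule holomorphic_contract_to_zero[of c0 r "h y"])
      show "continuous_on (cball c0 r) (h y)" by (rule conth) (rule W)
      show "0 < r" by (rule r)
      show "h y holomorphic_on ball c0 r"
        unfolding h_def
      proof (intro holomorphic_intros)
        show "(\<lambda>c. g (c *\<^sub>C y)) holomorphic_on ball c0 r"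
          unfolding holomorphic_on_def field_differentiable_def
        proof (intro ballI exI)
          fix c assume "c \<in> ball c0 r"
          then have "c *\<^sub>C y \<in> U" using W by simp
          then have "((\<lambda>z. g (0 + z *\<^sub>C y)) has_field_derivative blinfun_apply (Fderiv g (c *\<^sub>C y)) y) (at c)"
            using holomorphic_map_on_Fderiv[OF g \<open>open U\<close>]
            by (intro slice_has_field_derivative) auto
          then show "((\<lambda>z. g (z *\<^sub>C y)) has_field_derivative blinfun_apply (Fderiv g (c *\<^sub>C y)) y)
              (at c within ball c0 r)"
            by (simp add: has_field_derivative_at_within)
        qed
      qed
      fix c assume "norm (c0 - c) = r"
      then have cs: "c \<in> sphere c0 r" by (simp add: dist_norm)
      have "norm (h y c0) < m / 2" using W(2)[of c0] h0 r(1) by simp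
      moreover have "m / 2 < norm (h y c)"
        using W(2)[of c] m(2)[OF cs] cs norm_triangle_ineq2[of "h y0 c" "h y c"]
        by (simp add: norm_minus_commute)
      ultimately show "norm (h y c0) < norm (h y c)" by simp
    qed
    have "norm (c - c0) < e" using c(1) r(2) by (simp add: dist_norm norm_minus_commute)
    moreover have "c *\<^sub>C y \<in> U" using W(1) c(1) by simp
    moreover have "g (c *\<^sub>C y) *\<^sub>C (c *\<^sub>C y) = y"
      using c(2) by (simp add: h_def scaleC_scaleC mult.commute)
    ultimately show ?thesis by blast
  qed
  with V(1,2) show ?thesis unfolding y0_def c0_def by blast
qed

text \<open>A local solution \<open>c y\<close> lies in \<open>U\<close>, so injectivity identifies
  it with the preimage of \<open>y\<close>. Its existence makes the image open, and closeness of
  \<open>c\<close> to \<open>inverse (g x)\<close> makes the inverse map continuous. The two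
  nonvanishing conditions let the rank-one formula invert \<open>DG(x)\<close>, which yields the
  derivative of the inverse.\<close>

lemma radial_multiple_biholomorphic:
  fixes g :: "'a::complex_normed_vector \<Rightarrow> complex"
  assumes g: "holomorphic_map_on g U" and "open U"
    and nz: "\<And>x. x \<in> U \<Longrightarrow> g x \<noteq> 0"
    and nz': "\<And>x. x \<in> U \<Longrightarrow> g x + blinfun_apply (Fderiv g x) x \<noteq> 0"
    and inj: "inj_on G U"
    and G: "\<And>x. x \<in> U \<Longrightarrow> G x = g x *\<^sub>C x"
  shows "biholomorphic_on G U"
proof -
  note D = holomorphic_map_on_Fderiv[OF g \<open>open U\<close>]
  define T where "T x h = g x *\<^sub>C h + blinfun_apply (Fderiv g x) h *\<^sub>C x" for x h
  have dG: "(G has_derivative T x) (at x)" if "x \<in> U" for x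
    unfolding T_def
    by (rule has_derivative_transform_within_open[OF scaleC_has_derivative[OF D(1)[OF that]] \<open>open U\<close> that])
      (simp add: G)
  have homT: "complex_homogeneous (T x)" if "x \<in> U" for x
    using D(2)[OF that]
    by (simp add: T_def complex_homogeneous_def scaleC_complex_def scaleC_scaleC scaleC_add_right mult.commute)
  have injg: "inj_on (\<lambda>x. g x *\<^sub>C x) U"
    using inj by (simp add: G cong: inj_on_cong)
  note local_inverse = radial_multiple_local_inverse[OF g \<open>open U\<close> nz injg]
  have inv: "inv_into U G y = c *\<^sub>C y" if "c *\<^sub>C y \<in> U" "g (c *\<^sub>C y) *\<^sub>C (c *\<^sub>C y) = y" for c y
    using inv_into_f_f[OF inj that(1)] G[OF that(1)] that(2) by simp
  have "\<exists>V. open V \<and> y \<in> V \<and> V \<subseteq> G ` U" if y: "y \<in> G ` U" for y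
  proof -
    obtain x where x: "x \<in> U" "y = g x *\<^sub>C x" using y G by auto
    obtain V where V: "open V" "g x *\<^sub>C x \<in> V"
      "\<And>y. y \<in> V \<Longrightarrow> \<exists>c. norm (c - inverse (g x)) < 1 \<and> c *\<^sub>C y \<in> U \<and> g (c *\<^sub>C y) *\<^sub>C (c *\<^sub>C y) = y"
      using local_inverse[OF _ x(1) zero_less_one] by blast
    have "V \<subseteq> G ` U"
    proof
      fix y assume "y \<in> V"
      then obtain c where c: "c *\<^sub>C y \<in> U" "g (c *\<^sub>C y) *\<^sub>C (c *\<^sub>C y) = y" using V(3) by blast
      then show "y \<in> G ` U" using G by (metis image_eqI)
    qed
    then show ?thesis using V x by blast
  qed
  then have op: "open (G ` U)" by (subst open_subopen) blast
  have cont: "continuous (at y0) (inv_into U G)" if y0: "y0 \<in> G ` U" for y0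
    unfolding continuous_at_eps_delta
  proof (intro allI impI)
    fix \<epsilon> :: real assume "\<epsilon> > 0"
    obtain x where x: "x \<in> U" "y0 = g x *\<^sub>C x" using y0 G by auto
    define c0 where "c0 = inverse (g x)"
    have "c0 *\<^sub>C y0 = x" using nz[OF x(1)] by (simp add: x(2) c0_def scaleC_scaleC)
    then have iy0: "inv_into U G y0 = c0 *\<^sub>C y0" using x by (intro inv) auto
    \<comment> \<open>The bound 1 keeps \<open>norm c \<le> norm c0 + 1\<close>; the other one gives
      \<open>e * norm y0 \<le> \<epsilon> / 2\<close>, with \<open>+ 1\<close> keeping
      \<open>e\<close> positive when \<open>y0 = 0\<close>.\<close>
    define e where "e = min 1 (\<epsilon> / (2 * (norm y0 + 1)))"
    have n0: "norm y0 + 1 > 0" by (smt (verit) norm_ge_zero)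
    have "e > 0" using \<open>\<epsilon> > 0\<close> n0 by (simp add: e_def)
    have "e * (norm y0 + 1) \<le> \<epsilon> / (2 * (norm y0 + 1)) * (norm y0 + 1)"
      using n0 by (intro mult_right_mono) (auto simp: e_def)
    also have "\<dots> = \<epsilon> / 2" using n0 by (simp add: field_simps)
    finally have e2: "e * norm y0 \<le> \<epsilon> / 2" using \<open>e > 0\<close> by (simp add: algebra_simps)
    obtain V where V: "open V" "y0 \<in> V"
      "\<And>y. y \<in> V \<Longrightarrow> \<exists>c. norm (c - c0) < e \<and> c *\<^sub>C y \<in> U \<and> g (c *\<^sub>C y) *\<^sub>C (c *\<^sub>C y) = y"
      using local_inverse[OF _ x(1) \<open>e > 0\<close>] unfolding c0_def x(2) by blast
    obtain d1 where d1: "d1 > 0" "ball y0 d1 \<subseteq> V" using V openE by blast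
    define K where "K = norm c0 + 1"
    have "K > 0" unfolding K_def by (smt (verit) norm_ge_zero)
    define d where "d = min d1 (\<epsilon> / (2 * K))"
    have "d > 0" using d1 \<open>\<epsilon> > 0\<close> \<open>K > 0\<close> by (simp add: d_def)
    show "\<exists>d>0. \<forall>y. dist y y0 < d \<longrightarrow> dist (inv_into U G y) (inv_into U G y0) < \<epsilon>"
    proof (intro exI conjI allI impI)
      show "d > 0" by fact
      fix y assume y: "dist y y0 < d"
      then have "y \<in> V" using d1 by (auto simp: d_def dist_commute)
      then obtain c where c: "norm (c - c0) < e" "inv_into U G y = c *\<^sub>C y" using V(3) inv by blast
      have "norm c \<le> K"
        using c(1) norm_triangle_sub[of c c0] by (simp add: K_def e_def)
      have "c *\<^sub>C y - c0 *\<^sub>C y0 = c *\<^sub>C (y - y0) + (c - c0) *\<^sub>C y0"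
        by (simp add: scaleC.diff_left scaleC.diff_right)
      then have "norm (c *\<^sub>C y - c0 *\<^sub>C y0) \<le> norm c * norm (y - y0) + norm (c - c0) * norm y0"
        by (metis norm_scaleC norm_triangle_ineq)
      also have "norm c * norm (y - y0) \<le> K * norm (y - y0)"
        using \<open>norm c \<le> K\<close> by (rule mult_right_mono) simp
      also have "K * norm (y - y0) < K * (\<epsilon> / (2 * K))"
        using y \<open>K > 0\<close> by (intro mult_strict_left_mono) (auto simp: d_def dist_norm)
      also have "K * (\<epsilon> / (2 * K)) = \<epsilon> / 2" using \<open>K > 0\<close> by simp
      also have "norm (c - c0) * norm y0 \<le> e * norm y0"
        using c(1) by (intro mult_right_mono) auto
      also note e2
      finally show "dist (inv_into U G y) (inv_into U G y0) < \<epsilon>"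
        by (simp add: c(2) iy0 dist_norm)
    qed
  qed
  have "holomorphic_map_on (inv_into U G) (G ` U)"
  proof (rule holomorphic_map_onI)
    fix y assume y: "y \<in> G ` U"
    define x where "x = inv_into U G y"
    have x: "x \<in> U" unfolding x_def by (rule inv_into_into[OF y])
    note inverse = scalar_plus_rank_one_inverse[OF blinfun.bounded_linear_right D(2)[OF x] nz[OF x] nz'[OF x]]
    define S where "S = (\<lambda>w. inverse (g x) *\<^sub>C (w - (blinfun_apply (Fderiv g x) w /
        (g x + blinfun_apply (Fderiv g x) x)) *\<^sub>C x))"
    show "(inv_into U G has_derivative (\<lambda>w. inverse (g (inv_into U G y)) *\<^sub>C
        (w - (blinfun_apply (Fderiv g (inv_into U G y)) w / (g (inv_into U G y) +
          blinfun_apply (Fderiv g (inv_into U G y)) (inv_into U G y))) *\<^sub>C inv_into U G y))) (at y)"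
      unfolding x_def[symmetric] S_def[symmetric]
    proof (rule has_derivative_inverse_basic[of G "T x"])
      show "(G has_derivative T x) (at (inv_into U G y))" using dG[OF x] by (simp add: x_def)
      show "bounded_linear S" using inverse(3) by (simp add: S_def)
      show "S \<circ> T x = id" using inverse(2) by (auto simp: S_def T_def)
      show "continuous (at y) (inv_into U G)" by (rule cont[OF y])
      show "G (inv_into U G z) = z" if "z \<in> G ` U" for z using that by (rule f_inv_into_f)
    qed (use op y in auto)
    show "complex_homogeneous (\<lambda>w. inverse (g (inv_into U G y)) *\<^sub>C
        (w - (blinfun_apply (Fderiv g (inv_into U G y)) w / (g (inv_into U G y) +
          blinfun_apply (Fderiv g (inv_into U G y)) (inv_into U G y))) *\<^sub>C inv_into U G y))"
      using inverse(4) by (simp add: x_def)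
  qed
  moreover have "holomorphic_map_on G U"
    using dG homT by (rule holomorphic_map_onI)
  ultimately show ?thesis
    unfolding biholomorphic_on_def using inj op by blast
qed

section \<open>The factor \<open>g\<close> in \<open>G(x) = g(x) x\<close>\<close>

definition radial_factor :: "('a::complex_normed_vector \<Rightarrow> complex) \<Rightarrow> 'a \<Rightarrow> complex"
  where "radial_factor f x = f x + blinfun_apply (Fderiv f x) x"

context
  fixes f :: "'a::complex_banach \<Rightarrow> complex" and F :: "'a \<Rightarrow> 'a"
  assumes f: "holomorphic_map_on f (ball 0 1)"
    and f0: "f 0 = 1"
    and F: "\<forall>x\<in>ball 0 1. F x = f x *\<^sub>C x"
begin

lemmas Df = holomorphic_map_on_Fderiv[OF f open_ball]

lemma F_has_derivative:
  assumes x: "x \<in> ball 0 1"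
  shows "(F has_derivative (\<lambda>h. f x *\<^sub>C h + blinfun_apply (Fderiv f x) h *\<^sub>C x)) (at x)"
  by (rule has_derivative_transform_within_open[OF scaleC_has_derivative[OF Df(1)[OF x]] open_ball x])
    (simp add: F)

lemma Fderiv_F:
  assumes "x \<in> ball 0 1"
  shows "blinfun_apply (Fderiv F x) = (\<lambda>h. f x *\<^sub>C h + blinfun_apply (Fderiv f x) h *\<^sub>C x)"
  by (rule Fderiv_apply_eqI[OF F_has_derivative[OF assms]])

lemma Fderiv_F_homogeneous:
  assumes "x \<in> ball 0 1"
  shows "complex_homogeneous (blinfun_apply (Fderiv F x))"
  using Df(2)[OF assms] unfolding Fderiv_F[OF assms]
  by (simp add: complex_homogeneous_def scaleC_complex_def scaleC_scaleC scaleC_add_right mult.commute)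

lemma F_holomorphic: "holomorphic_map_on F (ball 0 1)"
  using F_has_derivative Fderiv_F_homogeneous Fderiv_F by (intro holomorphic_map_onI) auto

lemma F_normalized: "normalized_map F"
proof -
  have 0: "(0::'a) \<in> ball 0 1" by simp
  have "Fderiv F 0 = id_blinfun"
    by (rule blinfun_eqI) (simp add: Fderiv_F[OF 0] f0 scaleC.zero_right)
  then show ?thesis by (simp add: normalized_map_def F scaleC.zero_right)
qed

lemma Fderiv_F_radial:
  assumes "x \<in> ball 0 1"
  shows "blinfun_apply (Fderiv F x) x = radial_factor f x *\<^sub>C x"
  by (simp add: Fderiv_F[OF assms] radial_factor_def scaleC_add_left)

lemma radial_factor_0: "radial_factor f 0 = 1"
  by (simp add: radial_factor_def f0)

text \<open>\<open>B\<close> is \<open>D\<^sup>2f(x)\<close>. It is exposed because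
  \<open>D\<^sup>2F(x)\<close> is computed from the same \<open>B\<close>.\<close>

lemma radial_factor_has_derivative:
  assumes x: "x \<in> ball 0 1"
  obtains B where "(Fderiv f has_derivative B) (at x)"
    and "(radial_factor f has_derivative (\<lambda>h. blinfun_apply (Fderiv f x) h +
      (blinfun_apply (Fderiv f x) h + blinfun_apply (B h) x))) (at x)"
    and "complex_homogeneous (\<lambda>h. blinfun_apply (Fderiv f x) h +
      (blinfun_apply (Fderiv f x) h + blinfun_apply (B h) x))"
proof -
  obtain B where B: "(Fderiv f has_derivative B) (at x)"
    "\<And>k. complex_homogeneous (\<lambda>h. blinfun_apply (B h) k)"
    using Fderiv_has_derivative[OF f open_ball x] by metis
  show thesis
  proof (rule that[OF B(1)])
    show "(radial_factor f has_derivative (\<lambda>h. blinfun_apply (Fderiv f x) h +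
      (blinfun_apply (Fderiv f x) h + blinfun_apply (B h) x))) (at x)"
      unfolding radial_factor_def[abs_def]
      by (intro has_derivative_add Df(1)[OF x] blinfun.FDERIV[OF B(1) has_derivative_ident])
    show "complex_homogeneous (\<lambda>h. blinfun_apply (Fderiv f x) h +
      (blinfun_apply (Fderiv f x) h + blinfun_apply (B h) x))"
      using B(2) Df(2)[OF x] by (simp add: complex_homogeneous_complex algebra_simps)
  qed
qed

lemma radial_factor_holomorphic: "holomorphic_map_on (radial_factor f) (ball 0 1)"
  unfolding holomorphic_map_on_def
  by (meson radial_factor_has_derivative has_derivative_at_withinI)

text \<open>Differentiating \<open>DF(x) h = f(x) h + Df(x)(h) x\<close> gives
  \<open>(D\<^sup>2f(x)(x, x) + 2 Df(x) x) x\<close> on the diagonal, and the product rule for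
  \<open>g(x) = f(x) + Df(x) x\<close> gives the same scalar.\<close>

lemma Fderiv2_F_radial:
  assumes x: "x \<in> ball 0 1"
  shows "blinfun_apply (blinfun_apply (Fderiv2 F x) x) x =
    blinfun_apply (Fderiv (radial_factor f) x) x *\<^sub>C x"
proof -
  obtain B where B: "(Fderiv f has_derivative B) (at x)"
    "(radial_factor f has_derivative (\<lambda>h. blinfun_apply (Fderiv f x) h +
      (blinfun_apply (Fderiv f x) h + blinfun_apply (B h) x))) (at x)"
    using radial_factor_has_derivative[OF x] by metis
  \<comment> \<open>\<open>Fderiv F\<close> has to be differentiated as an operator-valued map, so
    it is assembled from bounded operations on operators: \<open>prod_right c\<close> is
    multiplication by \<open>c\<close>, and \<open>prod_left y\<close> sends \<open>c\<close> to
    \<open>c *\<^sub>C y\<close>.\<close>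
  have eq: "Fderiv F y = scaleC.prod_right (f y) + (scaleC.prod_left y o\<^sub>L Fderiv f y)"
    if "y \<in> ball 0 1" for y
    by (rule blinfun_eqI) (simp add: Fderiv_F[OF that] plus_blinfun.rep_eq)
  have "((\<lambda>y. scaleC.prod_right (f y) + (scaleC.prod_left y o\<^sub>L Fderiv f y)) has_derivative
      (\<lambda>k. scaleC.prod_right (blinfun_apply (Fderiv f x) k) +
        ((scaleC.prod_left x o\<^sub>L B k) + (scaleC.prod_left k o\<^sub>L Fderiv f x)))) (at x)"
    by (intro has_derivative_add bounded_bilinear.FDERIV[OF bounded_bilinear_blinfun_compose]
        bounded_linear.has_derivative[OF scaleC.bounded_linear_prod_right]
        bounded_linear.has_derivative[OF scaleC.bounded_linear_prod_left] Df(1)[OF x] B(1)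
        has_derivative_ident)
  then have "(Fderiv F has_derivative
      (\<lambda>k. scaleC.prod_right (blinfun_apply (Fderiv f x) k) +
        ((scaleC.prod_left x o\<^sub>L B k) + (scaleC.prod_left k o\<^sub>L Fderiv f x)))) (at x)"
    by (rule has_derivative_transform_within_open[OF _ open_ball x]) (simp add: eq)
  from Fderiv_apply_eqI[OF this] Fderiv_apply_eqI[OF B(2)]
  have "blinfun_apply (blinfun_apply (Fderiv2 F x) x) x =
      blinfun_apply (B x) x *\<^sub>C x + (blinfun_apply (Fderiv f x) x *\<^sub>C x + blinfun_apply (Fderiv f x) x *\<^sub>C x)"
    and "blinfun_apply (Fderiv (radial_factor f) x) x =
      blinfun_apply (B x) x + (blinfun_apply (Fderiv f x) x + blinfun_apply (Fderiv f x) x)"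
    by (simp_all add: Fderiv2_def plus_blinfun.rep_eq)
  then show ?thesis by (simp only: scaleC_add_left)
qed

text \<open>The argument of the inverse lies on the line through \<open>x\<close>, which
  \<open>DF(x)\<close> multiplies by \<open>radial_factor f x\<close>; the inverse divides by that
  factor.\<close>

lemma inv_Fderiv_F_radial:
  assumes x: "x \<in> ball 0 1" and nz: "radial_factor f x \<noteq> 0" and "inj (blinfun_apply (Fderiv F x))"
  shows "inv (blinfun_apply (Fderiv F x))
      (blinfun_apply (blinfun_apply (Fderiv2 F x) x) x + blinfun_apply (Fderiv F x) x) =
    (1 + blinfun_apply (Fderiv (radial_factor f) x) x / radial_factor f x) *\<^sub>C x"
proof (rule inv_f_eq[OF assms(3)])
  let ?g = "radial_factor f x" and ?d = "blinfun_apply (Fderiv (radial_factor f) x) x"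
  have "blinfun_apply (Fderiv F x) ((1 + ?d / ?g) *\<^sub>C x) = ((1 + ?d / ?g) * ?g) *\<^sub>C x"
    using Fderiv_F_homogeneous[OF x] Fderiv_F_radial[OF x]
    by (simp add: complex_homogeneous_def scaleC_scaleC)
  also have "(1 + ?d / ?g) * ?g = ?d + ?g" using nz by (simp add: field_simps)
  finally show "blinfun_apply (Fderiv F x) ((1 + ?d / ?g) *\<^sub>C x) =
      blinfun_apply (blinfun_apply (Fderiv2 F x) x) x + blinfun_apply (Fderiv F x) x"
    by (simp add: Fderiv2_F_radial[OF x] Fderiv_F_radial[OF x] scaleC_add_left)
qed

text \<open>A support functional sends \<open>Q *\<^sub>C x\<close> to \<open>Q * norm x\<close>, so
  all of them express the same condition \<open>Re Q > 0\<close>, and one exists. At the origin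
  \<open>Q = 1\<close>, so the condition extends to the whole ball. The radial factor cannot vanish
  because \<open>DF(x)\<close> is injective.\<close>

lemma quasi_convex_type_B_iff:
  "quasi_convex_type_B F \<longleftrightarrow> locally_biholomorphic_on F (ball 0 1) \<and>
    (\<forall>x\<in>ball 0 1. radial_factor f x \<noteq> 0 \<and>
      Re (1 + blinfun_apply (Fderiv (radial_factor f) x) x / radial_factor f x) > 0)"
proof -
  have nz: "radial_factor f x \<noteq> 0"
    if "locally_biholomorphic_on F (ball 0 1)" and x: "x \<in> ball 0 1" for x
  proof (cases "x = 0")
    case False
    have "inj (blinfun_apply (Fderiv F x))"
      using that by (auto simp: locally_biholomorphic_on_def bij_def)
    then have "blinfun_apply (Fderiv F x) x \<noteq> 0"
      using False blinfun.zero_right by (metis injD)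
    then show ?thesis using Fderiv_F_radial[OF x] by auto
  qed (simp add: radial_factor_0)
  have *: "(\<forall>l\<in>support_functionals x. Re (blinfun_apply l (inv (blinfun_apply (Fderiv F x))
        (blinfun_apply (blinfun_apply (Fderiv2 F x) x) x + blinfun_apply (Fderiv F x) x))) > 0) \<longleftrightarrow>
      Re (1 + blinfun_apply (Fderiv (radial_factor f) x) x / radial_factor f x) > 0"
    if loc: "locally_biholomorphic_on F (ball 0 1)" and x: "x \<in> ball 0 1" "x \<noteq> 0" for x
  proof -
    define Q where "Q = 1 + blinfun_apply (Fderiv (radial_factor f) x) x / radial_factor f x"
    have "inj (blinfun_apply (Fderiv F x))"
      using loc x(1) by (auto simp: locally_biholomorphic_on_def bij_def)
    note inv = inv_Fderiv_F_radial[OF x(1) nz[OF loc x(1)] this, folded Q_def]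
    have l: "Re (blinfun_apply l (Q *\<^sub>C x)) > 0 \<longleftrightarrow> Re Q > 0" if "l \<in> support_functionals x" for l
      using that x(2)
      by (simp add: support_functionals_def complex_homogeneous_complex zero_less_mult_iff)
    show ?thesis
      unfolding inv Q_def[symmetric] using l support_functionals_nonempty[OF x(2)] by blast
  qed
  have 0: "Re (1 + blinfun_apply (Fderiv (radial_factor f) 0) 0 / radial_factor f 0) > 0"
    by (simp add: blinfun.zero_right)
  have "(\<forall>x\<in>ball 0 1 - {0}. \<forall>l\<in>support_functionals x.
        Re (blinfun_apply l (inv (blinfun_apply (Fderiv F x))
          (blinfun_apply (blinfun_apply (Fderiv2 F x) x) x + blinfun_apply (Fderiv F x) x))) > 0) \<longleftrightarrow>
      (\<forall>x\<in>ball 0 1.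
        Re (1 + blinfun_apply (Fderiv (radial_factor f) x) x / radial_factor f x) > 0)"
    if "locally_biholomorphic_on F (ball 0 1)"
    using *[OF that] 0 by (metis (no_types, lifting) DiffD1 DiffD2 DiffI singleton_iff)
  then show ?thesis
    unfolding quasi_convex_type_B_def using F_holomorphic F_normalized nz by blast
qed

text \<open>By complex homogeneity \<open>z Dq(z u) u = Dq(z u)(z u)\<close>: the radial derivative
  at a point is the Euler operator \<open>z d/dz\<close> on its slice.\<close>

lemma slice_radial_factor:
  assumes u: "norm u = 1"
  shows "(\<lambda>z. radial_factor f (z *\<^sub>C u)) holomorphic_on ball 0 1"
    and "z \<in> ball 0 1 \<Longrightarrow>
      z * deriv (\<lambda>z. radial_factor f (z *\<^sub>C u)) z =
      blinfun_apply (Fderiv (radial_factor f) (z *\<^sub>C u)) (z *\<^sub>C u)"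
    and "(\<lambda>z. f (z *\<^sub>C u)) holomorphic_on ball 0 1"
    and "z \<in> ball 0 1 \<Longrightarrow>
      radial_factor f (z *\<^sub>C u) = f (z *\<^sub>C u) + z * deriv (\<lambda>z. f (z *\<^sub>C u)) z"
proof -
  have n: "norm (z *\<^sub>C u) < 1" if "z \<in> ball 0 1" for z
    using that u by (simp add: norm_scaleC)
  have slice: "(\<lambda>z. q (z *\<^sub>C u)) holomorphic_on ball 0 1"
    "z \<in> ball 0 1 \<Longrightarrow> z * deriv (\<lambda>z. q (z *\<^sub>C u)) z = blinfun_apply (Fderiv q (z *\<^sub>C u)) (z *\<^sub>C u)"
    if q: "holomorphic_map_on q (ball 0 1)" for q :: "'a \<Rightarrow> complex" and z
  proof -
    show "(\<lambda>z. q (z *\<^sub>C u)) holomorphic_on ball 0 1"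
      using slice_holomorphic_on(1)[where S = "ball 0 1", OF q n] by simp
    assume z: "z \<in> ball 0 1"
    have "deriv (\<lambda>z. q (z *\<^sub>C u)) z = blinfun_apply (Fderiv q (z *\<^sub>C u)) u"
      using slice_holomorphic_on(2)[OF q n z] by (simp add: DERIV_imp_deriv)
    moreover have "complex_homogeneous (blinfun_apply (Fderiv q (z *\<^sub>C u)))"
      using holomorphic_map_on_Fderiv(2)[OF q open_ball] n[OF z] by simp
    ultimately show "z * deriv (\<lambda>z. q (z *\<^sub>C u)) z = blinfun_apply (Fderiv q (z *\<^sub>C u)) (z *\<^sub>C u)"
      by (simp add: complex_homogeneous_complex)
  qed
  show "(\<lambda>z. radial_factor f (z *\<^sub>C u)) holomorphic_on ball 0 1"
    "(\<lambda>z. f (z *\<^sub>C u)) holomorphic_on ball 0 1"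
    using slice(1) f radial_factor_holomorphic by blast+
  assume z: "z \<in> ball 0 1"
  show "z * deriv (\<lambda>z. radial_factor f (z *\<^sub>C u)) z =
      blinfun_apply (Fderiv (radial_factor f) (z *\<^sub>C u)) (z *\<^sub>C u)"
    using slice(2)[OF radial_factor_holomorphic z] .
  show "radial_factor f (z *\<^sub>C u) = f (z *\<^sub>C u) + z * deriv (\<lambda>z. f (z *\<^sub>C u)) z"
    using slice(2)[OF f z] by (simp add: radial_factor_def)
qed

end

section \<open>The two implications, reduced to slices by unit vectors\<close>

lemma exists_unit_multiple:
  fixes x :: "'a::complex_normed_vector"
  assumes "x \<noteq> 0"
  obtains u where "norm u = 1" "x = complex_of_real (norm x) *\<^sub>C u"
proof
  show "norm (inverse (norm x) *\<^sub>R x) = 1" using assms by simp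
  show "x = complex_of_real (norm x) *\<^sub>C (inverse (norm x) *\<^sub>R x)"
    using assms by (simp add: scaleC_of_real)
qed

context
  fixes f :: "'a::complex_banach \<Rightarrow> complex" and F G :: "'a \<Rightarrow> 'a"
  assumes f: "holomorphic_map_on f (ball 0 1)"
    and f0: "f 0 = 1"
    and F: "\<forall>x\<in>ball 0 1. F x = f x *\<^sub>C x"
    and G': "\<forall>x\<in>ball 0 1. G x = blinfun_apply (Fderiv F x) x"
begin

lemma G: "x \<in> ball 0 1 \<Longrightarrow> G x = radial_factor f x *\<^sub>C x"
  using G' Fderiv_F_radial[OF f f0 F] by simp

lemma quasi_convex_imp_starlike:
  assumes "quasi_convex_type_B F"
  shows "starlike_map G"
proof -
  let ?g = "radial_factor f"
  note ghol = radial_factor_holomorphic[OF f f0 F]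
  have nz: "?g x \<noteq> 0" and pos: "Re (1 + blinfun_apply (Fderiv ?g x) x / ?g x) > 0"
    if "x \<in> ball 0 1" for x
    using assms that quasi_convex_type_B_iff[OF f f0 F] by auto
  have slice: "inj_on (\<lambda>z. z * ?g (z *\<^sub>C u)) (ball 0 1)"
    "\<And>z t. z \<in> ball 0 1 \<Longrightarrow> 0 \<le> t \<Longrightarrow> t \<le> 1 \<Longrightarrow>
      \<exists>w\<in>ball 0 1. w * ?g (w *\<^sub>C u) = complex_of_real t * (z * ?g (z *\<^sub>C u))" if u: "norm u = 1" for u
  proof -
    note s = slice_radial_factor[OF f f0 F u]
    have n: "z *\<^sub>C u \<in> ball 0 1" if "z \<in> ball 0 1" for z using that u by (simp add: norm_scaleC)
    have p: "Re (1 + z * deriv (\<lambda>z. ?g (z *\<^sub>C u)) z / ?g (z *\<^sub>C u)) > 0" if "z \<in> ball 0 1" for z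
      using pos[OF n[OF that]] s(2)[OF that] by simp
    show "inj_on (\<lambda>z. z * ?g (z *\<^sub>C u)) (ball 0 1)"
      "\<And>z t. z \<in> ball 0 1 \<Longrightarrow> 0 \<le> t \<Longrightarrow> t \<le> 1 \<Longrightarrow>
      \<exists>w\<in>ball 0 1. w * ?g (w *\<^sub>C u) = complex_of_real t * (z * ?g (z *\<^sub>C u))"
      using Re_pos_imp_starlike[OF s(1) nz[OF n] p] by auto
  qed
  have inj: "inj_on G (ball 0 1)"
  proof (rule inj_onI)
    fix x y assume x: "x \<in> ball 0 1" and y: "y \<in> ball 0 1" and eq: "G x = G y"
    then have eq': "?g x *\<^sub>C x = ?g y *\<^sub>C y" by (simp add: G)
    show "x = y"
    proof (cases "x = 0")
      case True
      then show ?thesis using eq' nz[OF y] by (metis scaleC_eq_0_iff)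
    next
      case False
      obtain u where u: "norm u = 1" "x = complex_of_real (norm x) *\<^sub>C u"
        using exists_unit_multiple[OF False] .
      \<comment> \<open>\<open>g(y) y = g(x) x\<close> with \<open>g(y) \<noteq> 0\<close> puts
        \<open>y\<close> on the slice of \<open>x\<close>; \<open>z\<close> is its coordinate
        there.\<close>
      define z where "z = inverse (?g y) * ?g x * norm x"
      have "y = inverse (?g y) *\<^sub>C (?g x *\<^sub>C x)"
        unfolding eq' using nz[OF y] by (simp add: scaleC_scaleC)
      also have "\<dots> = z *\<^sub>C u"
        by (subst (2) u(2)) (simp add: scaleC_scaleC z_def mult.assoc)
      finally have yz: "y = z *\<^sub>C u" .
      then have z: "z \<in> ball 0 1" using y u(1) by (simp add: norm_scaleC)
      have n: "complex_of_real (norm x) \<in> ball 0 1" using x by simp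
      have "z * ?g (z *\<^sub>C u) = complex_of_real (norm x) * ?g (complex_of_real (norm x) *\<^sub>C u)"
        using nz[OF y] unfolding yz[symmetric] u(2)[symmetric] by (simp add: z_def)
      then have "z = complex_of_real (norm x)"
        by (rule inj_onD[OF slice(1)[OF u(1)] _ z n])
      then show ?thesis using yz u(2) by simp
    qed
  qed
  \<comment> \<open>This is the eigenvalue of \<open>DG(x)\<close> on the line through
    \<open>x\<close>, equal to \<open>g(x)\<close> times the number whose real part is
    positive.\<close>
  have "?g x + blinfun_apply (Fderiv ?g x) x \<noteq> 0" if "x \<in> ball 0 1" for x
  proof
    assume "?g x + blinfun_apply (Fderiv ?g x) x = 0"
    then have "1 + blinfun_apply (Fderiv ?g x) x / ?g x = 0"
      using nz[OF that] by (simp add: field_simps)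
    then show False using pos[OF that] by simp
  qed
  then have bi: "biholomorphic_on G (ball 0 1)"
    using radial_multiple_biholomorphic[OF ghol open_ball nz _ inj G] by blast
  have star: "t *\<^sub>R G x \<in> G ` ball 0 1" if x: "x \<in> ball 0 1" and t: "0 \<le> t" "t \<le> 1" for x t
  proof (cases "x = 0")
    case True
    then show ?thesis using x by (auto simp: G scaleC.zero_right intro!: image_eqI[where x = 0])
  next
    case False
    obtain u where u: "norm u = 1" "x = complex_of_real (norm x) *\<^sub>C u"
      using exists_unit_multiple[OF False] .
    obtain w where w: "w \<in> ball 0 1" "w * ?g (w *\<^sub>C u) =
        complex_of_real t * (complex_of_real (norm x) * ?g (complex_of_real (norm x) *\<^sub>C u))"
      using slice(2)[OF u(1) _ t, of "complex_of_real (norm x)"] x by auto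
    have wu: "w *\<^sub>C u \<in> ball 0 1" using w(1) u(1) by (simp add: norm_scaleC)
    have "G (w *\<^sub>C u) = (w * ?g (w *\<^sub>C u)) *\<^sub>C u"
      using G[OF wu] by (simp add: scaleC_scaleC mult.commute)
    also have "\<dots> = t *\<^sub>R (?g x *\<^sub>C x)"
      unfolding w(2) u(2)[symmetric]
      by (subst (4) u(2)) (simp add: scaleC_scaleC mult_ac flip: scaleC_of_real)
    also have "\<dots> = t *\<^sub>R G x" using G[OF x] by simp
    finally show ?thesis using wu by (metis image_eqI)
  qed
  have seg: "closed_segment 0 y \<subseteq> G ` ball 0 1" if "y \<in> G ` ball 0 1" for y
    using that star by (auto simp: closed_segment_def)
  have "0 \<in> G ` ball 0 1" using G[of 0] by (auto simp: scaleC.zero_right intro!: image_eqI[where x = 0])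
  moreover have "connected (G ` ball 0 1)"
    using seg \<open>0 \<in> G ` ball 0 1\<close>
    by (intro starlike_imp_connected) (unfold starlike_def, blast)
  ultimately show ?thesis
    using bi seg unfolding starlike_map_def starlike_domain_origin_def biholomorphic_on_def by blast
qed

text \<open>Slices inherit injectivity and starlikeness from \<open>G\<close>: a preimage of
  \<open>t G(z u)\<close> is parallel to \<open>u\<close> because \<open>g\<close> has no zeros, so
  it lies in the same slice.\<close>

lemma starlike_imp_quasi_convex:
  assumes "starlike_map G"
  shows "quasi_convex_type_B F"
proof -
  let ?g = "radial_factor f"
  have inj: "inj_on G (ball 0 1)" and seg: "\<And>y. y \<in> G ` ball 0 1 \<Longrightarrow> closed_segment 0 y \<subseteq> G ` ball 0 1"
    using assms unfolding starlike_map_def biholomorphic_on_def starlike_domain_origin_def by auto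
  have G0: "G 0 = 0" using G[of 0] by (simp add: scaleC.zero_right)
  have nz: "?g x \<noteq> 0" if "x \<in> ball 0 1" for x
  proof
    assume "?g x = 0"
    then have "G x = G 0" using G[OF that] G0 by (simp add: scaleC.zero_left)
    then have "x = 0" using inj_onD[OF inj _ that, of 0] by simp
    then show False using \<open>?g x = 0\<close> radial_factor_0[OF f f0 F] by simp
  qed
  have slice: "Re (1 + z * deriv (\<lambda>z. ?g (z *\<^sub>C u)) z / ?g (z *\<^sub>C u)) > 0"
    if u: "norm u = 1" and z: "z \<in> ball 0 1" for u z
  proof (rule starlike_imp_Re_pos[OF _ _ _ _ z])
    have n: "z *\<^sub>C u \<in> ball 0 1" if "z \<in> ball 0 1" for z using that u by (simp add: norm_scaleC)
    have "u \<noteq> 0" using u by auto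
    have Gz: "G (z *\<^sub>C u) = (z * ?g (z *\<^sub>C u)) *\<^sub>C u" if "z \<in> ball 0 1" for z
      using G[OF n[OF that]] by (simp add: scaleC_scaleC mult.commute)
    show "(\<lambda>z. ?g (z *\<^sub>C u)) holomorphic_on ball 0 1"
      by (rule slice_radial_factor(1)[OF f f0 F u])
    show "?g (z *\<^sub>C u) \<noteq> 0" if "z \<in> ball 0 1" for z by (rule nz[OF n[OF that]])
    show "inj_on (\<lambda>z. z * ?g (z *\<^sub>C u)) (ball 0 1)"
    proof (rule inj_onI)
      fix z w assume zw: "z \<in> ball 0 1" "w \<in> ball 0 1" "z * ?g (z *\<^sub>C u) = w * ?g (w *\<^sub>C u)"
      then have "G (z *\<^sub>C u) = G (w *\<^sub>C u)" by (simp only: Gz)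
      then have "z *\<^sub>C u = w *\<^sub>C u"
        by (rule inj_onD[OF inj _ n[OF zw(1)] n[OF zw(2)]])
      then show "z = w" using \<open>u \<noteq> 0\<close> by (simp add: scaleC_cancel_right)
    qed
    fix z :: complex and t :: real assume z: "z \<in> ball 0 1" and t: "0 \<le> t" "t \<le> 1"
    have "t *\<^sub>R G (z *\<^sub>C u) \<in> closed_segment 0 (G (z *\<^sub>C u))"
      using t by (auto simp: closed_segment_def)
    then obtain x where x: "x \<in> ball 0 1" "t *\<^sub>R G (z *\<^sub>C u) = G x" using seg n[OF z] by blast
    \<comment> \<open>The coordinate of \<open>x\<close> on the slice, found by dividing
      \<open>g(x) x = t G(z u)\<close> by \<open>g(x)\<close>.\<close>
    define w where "w = inverse (?g x) * (of_real t * (z * ?g (z *\<^sub>C u)))"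
    have "?g x *\<^sub>C x = (of_real t * (z * ?g (z *\<^sub>C u))) *\<^sub>C u"
      using x G[OF x(1)] Gz[OF z] by (simp add: scaleC_scaleC flip: scaleC_of_real)
    then have "inverse (?g x) *\<^sub>C (?g x *\<^sub>C x) = w *\<^sub>C u"
      by (simp add: w_def scaleC_scaleC)
    then have xw: "x = w *\<^sub>C u" using nz[OF x(1)] by (simp add: scaleC_scaleC)
    show "\<exists>w\<in>ball 0 1. w * ?g (w *\<^sub>C u) = of_real t * (z * ?g (z *\<^sub>C u))"
    proof
      show "w * ?g (w *\<^sub>C u) = of_real t * (z * ?g (z *\<^sub>C u))"
        unfolding xw[symmetric] using nz[OF x(1)] by (simp add: w_def)
      show "w \<in> ball 0 1" using x(1) u xw by (simp add: norm_scaleC)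
    qed
  qed
  have pos: "Re (1 + blinfun_apply (Fderiv ?g x) x / ?g x) > 0" and fnz: "f x \<noteq> 0"
    if x: "x \<in> ball 0 1" for x
  proof -
    have "Re (1 + blinfun_apply (Fderiv ?g x) x / ?g x) > 0 \<and> f x \<noteq> 0"
    proof (cases "x = 0")
      case False
      obtain u where u: "norm u = 1" "x = complex_of_real (norm x) *\<^sub>C u"
        using exists_unit_multiple[OF False] .
      have z: "complex_of_real (norm x) \<in> ball 0 1" using x by simp
      note s = slice_radial_factor[OF f f0 F u(1)]
      have n: "z *\<^sub>C u \<in> ball 0 1" if "z \<in> ball 0 1" for z using that u by (simp add: norm_scaleC)
      \<comment> \<open>On the slice \<open>g\<close> is the derivative of
        \<open>z \<phi>(z)\<close>, so the positivity proved for \<open>g\<close> is the convexity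
        condition for \<open>z \<phi>(z)\<close>.\<close>
      have "f (complex_of_real (norm x) *\<^sub>C u) \<noteq> 0"
        by (rule convex_imp_nonvanishing[OF s(3) _ s(4) nz[OF n] slice[OF u(1)] z])
          (simp_all add: scaleC.zero_left f0)
      then show ?thesis
        using slice[OF u(1) z] s(2)[OF z] unfolding u(2)[symmetric] by simp
    qed (simp add: f0)
    then show "Re (1 + blinfun_apply (Fderiv ?g x) x / ?g x) > 0" "f x \<noteq> 0" by auto
  qed
  have "locally_biholomorphic_on F (ball 0 1)"
    unfolding locally_biholomorphic_on_def
  proof (intro conjI ballI F_holomorphic[OF f f0 F])
    fix x :: 'a assume x: "x \<in> ball 0 1"
    \<comment> \<open>Together with \<open>f x \<noteq> 0\<close> this is what the rank-one formula
      needs to invert \<open>DF(x)\<close>.\<close>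
    have g: "f x + blinfun_apply (Fderiv f x) x \<noteq> 0"
      using nz[OF x] by (simp add: radial_factor_def)
    note inverse = scalar_plus_rank_one_inverse[OF blinfun.bounded_linear_right
        holomorphic_map_on_Fderiv(2)[OF f open_ball x] fnz[OF x] g]
    have D: "blinfun_apply (Fderiv F x) h = f x *\<^sub>C h + blinfun_apply (Fderiv f x) h *\<^sub>C x" for h
      by (simp add: Fderiv_F[OF f f0 F x])
    have "\<exists>S. bounded_linear S \<and> (\<forall>w. blinfun_apply (Fderiv F x) (S w) = w) \<and>
        (\<forall>h. S (blinfun_apply (Fderiv F x) h) = h)"
      unfolding D
      \<comment> \<open>The witness stays schematic until \<open>inverse(3)\<close> fixes it as the
        rank-one inverse.\<close>
      by (rule exI, rule conjI, rule inverse(3), intro conjI allI, rule inverse(1), rule inverse(2))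
    then obtain S where S: "bounded_linear S" "blinfun_apply (Fderiv F x) \<circ> S = id"
        "S \<circ> blinfun_apply (Fderiv F x) = id"
      by (auto simp: fun_eq_iff)
    show "bij (blinfun_apply (Fderiv F x))" using S(3,2) by (rule o_bij)
    show "bounded_linear (inv (blinfun_apply (Fderiv F x)))"
      using S(1) unfolding inv_unique_comp[OF S(2,3)] .
  qed
  then show ?thesis
    using quasi_convex_type_B_iff[OF f f0 F] nz pos by auto
qed

end

theorem theorem3p15:
  fixes f :: "'a::complex_banach \<Rightarrow> complex"
    and F G :: "'a \<Rightarrow> 'a"
  assumes "holomorphic_map_on f (ball 0 1)"
    and "f 0 = 1"
    and "\<And>x. x \<in> ball 0 1 \<Longrightarrow> F x = f x *\<^sub>C x"
    and "\<And>x. x \<in> ball 0 1 \<Longrightarrow> G x = blinfun_apply (Fderiv F x) x"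
  shows "quasi_convex_type_B F \<longleftrightarrow> starlike_map G"
  using quasi_convex_imp_starlike[of f F G] starlike_imp_quasi_convex[of f F G] assms by blast

end
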